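(* Let $K$ be a knot type, $\Lambda,\Delta,\tau>0$ and $0<\varepsilon\le c\min\{1,\tau\}$, where $c>0$ is a fixed small universal constant, and use the concrete cubical–triangulated encoding scheme at resolution $\varepsilon$. Put $$N_{\Lambda,\Delta,\tau,\varepsilon}=\left\lceil C\left(\frac{\Lambda}{\varepsilon}+\frac{\Delta}{\varepsilon^2}\right)\right\rceil.$$ Then the number of encoded $\varepsilon$-types of pairs in $\mathcal Z^{\mathrm{ess}}_{\Lambda,\Delta,\tau}(K)$ is at most $$\bigl(C\,N_{\Lambda,\Delta,\tau,\varepsilon}\bigr)^{B\,N_{\Lambda,\Delta,\tau,\varepsilon}^2},$$ where $B,C>0$ are universal constants of the scheme. In particular, once the geometric budget and the resolution are fixed, the set of possible codes is bounded by an explicit function of $(\Lambda,\Delta,\tau,\varepsilon)$ and the chosen quantization constants.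
   Context: Ambient conventions. Identify $S^3=\mathbb R^3\cup\{\infty\}$; all lengths, areas, distances and reaches are Euclidean. A representative of a knot type $K$ is a $C^{1,1}$ embedded closed curve $\gamma\subset\mathbb R^3$ of type $K$; $\operatorname{Len}(\gamma)$ is its length and $\operatorname{Thi}(\gamma)$ its thickness, the radius of the largest embedded normal tube (equivalently, the Federer reach of $\gamma$). Fix $\rho_0=\tfrac12$. For $\operatorname{Thi}(\gamma)\ge1$, $N_{\rho_0}(\gamma)$ is the closed normal tube of radius $\rho_0$ and $E(\gamma)=S^3\setminus\operatorname{int}N_{\rho_0}(\gamma)$ is the exterior. Compact surfaces in $E(\gamma)$ are taken disjoint from $\infty$. Relative thickness. Universal constants $0<c_0<1$ and $L_0\ge1$ are fixed once and for all. Let $F\subset E(\gamma)$ be a compact properly embedded $C^{1,1}$ surface (possibly disconnected, non-orientable, or with boundary), and let $T=\partial E(\gamma)$. $\operatorname{Thi}(F)\ge r$ means that the following hold: (i) the closed set $F\subset\mathbb R^3$ (with its boundary) has Federer reach at least $r$; (ii) for every $x\in F\setminus\partial F$, in rigid coordinates with $x=0$ and $T_xF$ horizontal, there is a $C^{1,1}$ function $u$ on the disk of radius $c_0r$ in $T_xF$ with $u(0)=0$, $Du(0)=0$, whose $C^1$-norm and Lipschitz norm of $Du$ are bounded by $L_0$ after scaling by $r^{-1}$, with $F\cap B(x,c_0r)\subseteq\operatorname{graph}(u)$ and $\operatorname{graph}(u|_{\text{disk of radius }c_0r/2})\subseteq F$; (iii) for every $x\in\partial F$ the same holds with half-disks,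 $\partial F$ corresponding to the boundary diameter; (iv) the inward conormal collar map $C_F:[0,c_0r]\times\partial F\to F$, $C_F(0,p)=p$, is an embedding; for $p,q$ on the same component of $\partial F$, with $d_{\partial F}$ arclength distance, $L_0^{-1}\min\{r,|s-t|+d_{\partial F}(p,q)\}\le|C_F(s,p)-C_F(t,q)|\le L_0(|s-t|+d_{\partial F}(p,q))$; for $p,q$ on different components $|C_F(s,p)-C_F(t,q)|\ge c_0r$; and after scaling by $r^{-1}$ the first derivative of $C_F$ is bounded by $L_0$ and $L_0$-Lipschitz; (v) $\operatorname{dist}(C_F(s,p),T)\ge c_0s$ for $0\le s\le c_0r$, and $\operatorname{dist}(F\setminus C_F([0,c_0r/2]\times\partial F),T)\ge\tfrac{c_0^2}{4}r$ (with $F$ itself in place of the complement if $F$ is closed). $\operatorname{Thi}(F)$ is the largest such $r$ ($0$ if there is none). For disconnected $F$ the clauses are imposed on the union and area means total area. Essential. A compact properly embedded surface or finite surface system in $E(\gamma)$ is essential if every component is incompressible, boundary-incompressible and not boundary-parallel; a $2$-sphere is essential only if it bounds no ball in $E(\gamma)$ (so sphere components never occur). Parallel duplicate components are not allowed. $\mathcal Z^{\mathrm{ess}}_{\Lambda,\Delta,\tau}(K)$ is the set of pairs $(\gamma,F)$ with $\gamma$ a representative of $K$ (modulo orientation-preserving rigid motions), $\operatorname{Thi}(\gamma)=1$, $\operatorname{Len}(\gamma)\le\Lambda$, $F\subset E(\gamma)$ essential, $\operatorname{Thi}(F)\ge\tau$, $\operatorname{Area}(F)\le\Delta$; codes are attached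 to geometric pairs. Concrete cubical–triangulated encoding at resolution $\varepsilon$, with quantization scales $\delta_\gamma,\delta_F>0$. (a) Spatial labels are cubes of the fixed global lattice $\{\varepsilon(k+[-\tfrac12,\tfrac12)^3):k\in\mathbb Z^3\}$. After a rigid motion putting the barycenter of $\gamma$ at the origin, an essential pair lies in the cube of side $S=2(\tfrac\Lambda2+1+C_{\mathrm{diam}}\tfrac\Delta\tau)$ centered at the origin, where $C_{\mathrm{diam}}$ is a universal constant such that every connected surface with $\operatorname{Thi}\ge\tau$, $\operatorname{Area}\le\Delta$ has diameter at most $C_{\mathrm{diam}}\Delta/\tau$; only the finitely many lattice cubes meeting that cube are used as labels. (b) Alphabets: a $\delta_\gamma$-net $\mathcal D_\gamma\subset S^2$ of oriented knot tangent directions, a $\delta_F$-net $\mathcal D_\partial\subset S^2$ of oriented boundary tangents, a $\delta_F$-net $\widehat{\mathcal D}_F\subset\mathbb{RP}^2$ of unoriented surface normal lines, a fixed finite set $\mathcal B$ of boundary-collar/sheet type symbols, and a fixed finite set $\mathcal J$ of incidence symbols. The scale $\delta_F$ is a fixed constant, and $\delta_\gamma\le\varepsilon$ with $|\mathcal D_\gamma|=O(\varepsilon^{-2})$. (c) Curve layer: the cyclic list of (cube, quantized tangent) along an arclength $\varepsilon/2$-net of $\gamma$. (d) Surface and boundary layers: a bounded-geometry triangulation of $F$ of mesh at most $\varepsilon$ with fixed shape-regularity constants; for each triangle the cube containing its barycenter, its quantized unoriented normal line, and its label in $\mathcal B$, together with triangle adjacency; and each boundary component as a cyclic list of samples of an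 arclength $\varepsilon/2$-net with their cubes and quantized tangents. (e) Relative-position layer: for each (curve edge, triangle) in equal or neighbouring cubes, a symbol in $\mathcal J$. (f) Admissible discretizations are those using $O(\operatorname{Len}(\gamma)/\varepsilon)$ curve cells and $O(\operatorname{Area}(F)/\varepsilon^2)$ surface cells, with fixed universal implied constants. The encoded $\varepsilon$-type of the pair is the shortlex-least word among all raw words obtained from all admissible choices (rigid normalization, orientation, basepoints, nets, triangulations, orderings), for a fixed numbering of the global alphabet. *)

theory Defs
  imports "HOL-Analysis.Analysis"
begin

type_synonym pt = "real ^ 3"

section \<open>Geometric measure theory preliminaries\<close>

definition hausdorff_measure :: "nat \<Rightarrow> 'a::metric_space set \<Rightarrow> ennreal" where
  "hausdorff_measure k A =
     ennreal (unit_ball_vol (real k) / 2 ^ k) *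
     (SUP \<delta>\<in>{0<..}. INF U\<in>{U :: nat \<Rightarrow> 'a set. A \<subseteq> (\<Union>i. U i) \<and>
         (\<forall>i. bounded (U i) \<and> diameter (U i) \<le> \<delta>)}. \<Sum>i. ennreal (diameter (U i) ^ k))"

definition area :: "pt set \<Rightarrow> ennreal" where
  "area F = hausdorff_measure 2 F"

text \<open>Federer reach. The premise says that the distance from \<open>x\<close> to \<open>A\<close> is less than \<open>r\<close>
  (the empty set has infinite reach).\<close>

definition reach_at_least :: "pt set \<Rightarrow> real \<Rightarrow> bool" where
  "reach_at_least A r \<longleftrightarrow>
     (\<forall>x. (\<exists>a\<in>A. dist x a < r) \<longrightarrow> (\<exists>!a. a \<in> A \<and> (\<forall>b\<in>A. dist x a \<le> dist x b)))"

definition reach :: "pt set \<Rightarrow> ereal" where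
  "reach A = (SUP r\<in>{r. 0 \<le> r \<and> reach_at_least A r}. ereal r)"

text \<open>Federer's tangent cone; at a boundary point of a surface it is a half-plane.\<close>

definition tangent_cone :: "pt set \<Rightarrow> pt \<Rightarrow> pt set" where
  "tangent_cone A x = {v. \<forall>e>0. \<exists>y\<in>A. \<exists>a>0. norm (y - x) < e \<and> norm (a *\<^sub>R (y - x) - v) < e}"

definition tangent_space :: "pt set \<Rightarrow> pt \<Rightarrow> pt set" where
  "tangent_space A x = span (tangent_cone A x)"

section \<open>Curves and knot types\<close>

text \<open>\<open>g\<close> is an arclength parametrisation, of period \<open>L\<close>, of the \<open>C\<^sup>1\<^sup>,\<^sup>1\<close> embedded closed
  curve \<open>A\<close>; it carries a choice of orientation and of basepoint.\<close>

definition unit_speed :: "(real \<Rightarrow> pt) \<Rightarrow> real \<Rightarrow> pt set \<Rightarrow> bool" where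
  "unit_speed g L A \<longleftrightarrow>
     0 < L \<and> (\<forall>t. g (t + L) = g t) \<and> inj_on g {0..<L} \<and> range g = A \<and>
     (\<exists>g' M. (\<forall>t. (g has_vector_derivative g' t) (at t) \<and> norm (g' t) = 1) \<and>
             M-lipschitz_on UNIV g')"

definition closed_curve :: "pt set \<Rightarrow> bool" where
  "closed_curve A \<longleftrightarrow> (\<exists>g L. unit_speed g L A)"

text \<open>All arclength parametrisations of a closed curve have the same period, so the infimum is
  over a singleton.\<close>

definition curve_length :: "pt set \<Rightarrow> real" where
  "curve_length A = Inf {L. \<exists>g. unit_speed g L A}"

definition arclength_dist :: "pt set \<Rightarrow> pt \<Rightarrow> pt \<Rightarrow> real" where
  "arclength_dist A p q = Inf {\<bar>s - t\<bar> | s t. \<exists>g L. unit_speed g L A \<and> g s = p \<and> g t = q}"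

definition ambient_isotopic :: "pt set \<Rightarrow> pt set \<Rightarrow> bool" where
  "ambient_isotopic A B \<longleftrightarrow>
     (\<exists>H :: real \<times> pt \<Rightarrow> pt. continuous_on ({0..1} \<times> UNIV) H \<and>
        (\<forall>x. H (0, x) = x) \<and>
        (\<forall>t\<in>{0..1}. \<exists>H'. homeomorphism UNIV UNIV (\<lambda>x. H (t, x)) H') \<and>
        (\<lambda>x. H (1, x)) ` A = B)"

text \<open>A knot type is the set of all its \<open>C\<^sup>1\<^sup>,\<^sup>1\<close> representatives.\<close>

definition knot_type :: "pt set set \<Rightarrow> bool" where
  "knot_type K \<longleftrightarrow>
     (\<exists>\<gamma>\<^sub>0. closed_curve \<gamma>\<^sub>0 \<and> K = {\<gamma>. closed_curve \<gamma> \<and> ambient_isotopic \<gamma>\<^sub>0 \<gamma>})"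

section \<open>Tube and exterior\<close>

definition S3 :: "pt option topology" where
  "S3 = Alexandroff_compactification euclidean"

text \<open>The closed normal tube of radius \<open>\<rho>\<^sub>0 = 1/2\<close>.\<close>

definition tube :: "pt set \<Rightarrow> pt set" where
  "tube \<gamma> = {p + v | p v. p \<in> \<gamma> \<and> norm v \<le> 1/2 \<and> (\<forall>t\<in>tangent_cone \<gamma> p. v \<bullet> t = 0)}"

text \<open>The exterior in \<open>S\<^sup>3\<close>, its part in \<open>\<real>\<^sup>3\<close>, and its boundary torus \<open>T\<close>. Compact surfaces
  are disjoint from \<open>\<infinity>\<close>, so they are subsets of \<open>finite_exterior\<close>; three-dimensional regions
  may contain \<open>\<infinity>\<close> and live in \<open>exterior\<close>.\<close>

definition finite_exterior :: "pt set \<Rightarrow> pt set" where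
  "finite_exterior \<gamma> = - interior (tube \<gamma>)"

definition exterior :: "pt set \<Rightarrow> pt option set" where
  "exterior \<gamma> = insert None (Some ` finite_exterior \<gamma>)"

definition boundary_torus :: "pt set \<Rightarrow> pt set" where
  "boundary_torus \<gamma> = frontier (tube \<gamma>)"

section \<open>Surfaces\<close>

definition C11_on :: "pt set \<Rightarrow> (pt \<Rightarrow> pt) \<Rightarrow> bool" where
  "C11_on U f \<longleftrightarrow>
     (\<exists>f' :: pt \<Rightarrow> pt \<Rightarrow>\<^sub>L pt.
        (\<forall>x\<in>U. (f has_derivative blinfun_apply (f' x)) (at x)) \<and>
        (\<forall>x\<in>U. \<exists>e>0. \<exists>M. M-lipschitz_on (U \<inter> ball x e) f'))"

definition C11_diffeo :: "pt set \<Rightarrow> (pt \<Rightarrow> pt) \<Rightarrow> bool" where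
  "C11_diffeo U \<phi> \<longleftrightarrow>
     open U \<and> open (\<phi> ` U) \<and> inj_on \<phi> U \<and> C11_on U \<phi> \<and> C11_on (\<phi> ` U) (inv_into U \<phi>)"

definition surface_interior :: "pt set \<Rightarrow> pt set" where
  "surface_interior F =
     {x \<in> F. \<exists>U \<phi>. x \<in> U \<and> C11_diffeo U \<phi> \<and> \<phi> x = 0 \<and>
        \<phi> ` (F \<inter> U) = {y \<in> \<phi> ` U. y $ 3 = 0}}"

definition surface_boundary :: "pt set \<Rightarrow> pt set" where
  "surface_boundary F =
     {x \<in> F. \<exists>U \<phi>. x \<in> U \<and> C11_diffeo U \<phi> \<and> \<phi> x = 0 \<and>
        \<phi> ` (F \<inter> U) = {y \<in> \<phi> ` U. y $ 3 = 0 \<and> 0 \<le> y $ 2}}"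

definition proper_surface :: "pt set \<Rightarrow> pt set \<Rightarrow> bool" where
  "proper_surface \<gamma> F \<longleftrightarrow>
     compact F \<and> F = surface_interior F \<union> surface_boundary F \<and>
     F \<subseteq> finite_exterior \<gamma> \<and> F \<inter> boundary_torus \<gamma> = surface_boundary F"

section \<open>Relative thickness\<close>

definition inward_conormal :: "pt set \<Rightarrow> pt \<Rightarrow> pt \<Rightarrow> bool" where
  "inward_conormal F p \<nu> \<longleftrightarrow>
     norm \<nu> = 1 \<and> \<nu> \<in> tangent_cone F p \<and> (\<forall>v\<in>tangent_cone (surface_boundary F) p. \<nu> \<bullet> v = 0)"

text \<open>Interior graph condition. Norms are the maxima of the individual suprema, so scaling by
  \<open>1/r\<close> turns the bounds for \<open>u\<close>, \<open>Du\<close> and the Lipschitz constant of \<open>Du\<close> into \<open>L\<^sub>0 r\<close>,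
  \<open>L\<^sub>0\<close> and \<open>L\<^sub>0/r\<close>. Since no disk of a fixed radius around points close to \<open>\<partial>F\<close> can be
  contained in \<open>F\<close>, the second inclusion is required only at distance at least \<open>c\<^sub>0 r\<close> from
  \<open>\<partial>F\<close>; the boundary charts below cover the rest.\<close>

definition interior_graph :: "real \<Rightarrow> real \<Rightarrow> real \<Rightarrow> pt set \<Rightarrow> pt \<Rightarrow> bool" where
  "interior_graph c0 L0 r F x \<longleftrightarrow>
     (\<exists>n (u :: pt \<Rightarrow> real) (Du :: pt \<Rightarrow> pt).
        let D = {v \<in> tangent_space F x. norm v < c0 * r};
            gr = (\<lambda>v. x + v + u v *\<^sub>R n)
        in norm n = 1 \<and> (\<forall>v\<in>tangent_space F x. n \<bullet> v = 0) \<and>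
           u 0 = 0 \<and> Du 0 = 0 \<and>
           (\<forall>v\<in>D. Du v \<in> tangent_space F x \<and> (u has_derivative (\<lambda>h. Du v \<bullet> h)) (at v within D) \<and>
                  \<bar>u v\<bar> \<le> L0 * r \<and> norm (Du v) \<le> L0) \<and>
           (L0 / r)-lipschitz_on D Du \<and>
           F \<inter> ball x (c0 * r) \<subseteq> gr ` D \<and>
           ((\<forall>y\<in>surface_boundary F. c0 * r \<le> dist x y) \<longrightarrow>
              gr ` {v \<in> D. norm v < c0 * r / 2} \<subseteq> F))"

text \<open>Boundary charts. The displacement \<open>w\<close> from the tangent half-disk plays the role of \<open>u\<close>.
  It is vector valued: a normal displacement would force \<open>\<partial>F\<close> to project to a straight segment
  of the tangent plane, whereas here the diameter is allowed to bend within the surface.\<close>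

definition boundary_graph :: "real \<Rightarrow> real \<Rightarrow> real \<Rightarrow> pt set \<Rightarrow> pt \<Rightarrow> bool" where
  "boundary_graph c0 L0 r F x \<longleftrightarrow>
     (\<exists>\<nu> (w :: pt \<Rightarrow> pt) (Dw :: pt \<Rightarrow> pt \<Rightarrow>\<^sub>L pt).
        let H = {v \<in> tangent_space F x. norm v < c0 * r \<and> 0 \<le> v \<bullet> \<nu>};
            \<Phi> = (\<lambda>v. x + v + w v)
        in inward_conormal F x \<nu> \<and> w 0 = 0 \<and> Dw 0 = 0 \<and>
           (\<forall>v\<in>H. (w has_derivative blinfun_apply (Dw v)) (at v within H) \<and>
                  norm (w v) \<le> L0 * r \<and> norm (Dw v) \<le> L0) \<and>
           (L0 / r)-lipschitz_on H Dw \<and> inj_on \<Phi> H \<and>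
           F \<inter> ball x (c0 * r) \<subseteq> \<Phi> ` H \<and>
           \<Phi> ` {v \<in> H. norm v < c0 * r / 2} \<subseteq> F \<and>
           (\<forall>v\<in>H. \<Phi> v \<in> F \<inter> ball x (c0 * r) \<or> norm v < c0 * r / 2 \<longrightarrow>
                    (\<Phi> v \<in> surface_boundary F \<longleftrightarrow> v \<bullet> \<nu> = 0)))"

definition collar_map ::
    "real \<Rightarrow> real \<Rightarrow> real \<Rightarrow> pt set \<Rightarrow> (real \<times> pt \<Rightarrow> pt) \<Rightarrow> bool" where
  "collar_map c0 L0 r F CF \<longleftrightarrow>
     (let X = {0..c0 * r} \<times> surface_boundary F in
      CF ` X \<subseteq> F \<and> (\<exists>CF'. homeomorphism X (CF ` X) CF CF') \<and>
      (\<forall>p\<in>surface_boundary F. CF (0, p) = p \<and>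
         (\<exists>\<nu>. inward_conormal F p \<nu> \<and>
              ((\<lambda>s. CF (s, p)) has_vector_derivative \<nu>) (at 0 within {0..c0 * r}))) \<and>
      (\<forall>\<beta>\<in>components (surface_boundary F). \<forall>p\<in>\<beta>. \<forall>q\<in>\<beta>. \<forall>s\<in>{0..c0 * r}. \<forall>t\<in>{0..c0 * r}.
         min r (\<bar>s - t\<bar> + arclength_dist \<beta> p q) / L0 \<le> dist (CF (s, p)) (CF (t, q)) \<and>
         dist (CF (s, p)) (CF (t, q)) \<le> L0 * (\<bar>s - t\<bar> + arclength_dist \<beta> p q)) \<and>
      (\<forall>\<beta>\<in>components (surface_boundary F). \<forall>\<beta>'\<in>components (surface_boundary F). \<beta> \<noteq> \<beta>' \<longrightarrow>
         (\<forall>p\<in>\<beta>. \<forall>q\<in>\<beta>'. \<forall>s\<in>{0..c0 * r}. \<forall>t\<in>{0..c0 * r}.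
            c0 * r \<le> dist (CF (s, p)) (CF (t, q)))) \<and>
      (\<forall>\<beta>\<in>components (surface_boundary F). \<forall>g L. unit_speed g L \<beta> \<longrightarrow>
         (\<exists>D :: real \<times> real \<Rightarrow> (real \<times> real) \<Rightarrow>\<^sub>L pt.
            (\<forall>z\<in>{0..c0 * r} \<times> UNIV.
               ((\<lambda>(s, t). CF (s, g t)) has_derivative blinfun_apply (D z))
                 (at z within {0..c0 * r} \<times> UNIV) \<and> norm (D z) \<le> L0) \<and>
            (L0 / r)-lipschitz_on ({0..c0 * r} \<times> UNIV) D)))"

text \<open>\<open>surface_thickness_ge c\<^sub>0 L\<^sub>0 \<gamma> F r\<close> is \<open>Thi(F) \<ge> r\<close>.\<close>

definition surface_thickness_ge ::
    "real \<Rightarrow> real \<Rightarrow> pt set \<Rightarrow> pt set \<Rightarrow> real \<Rightarrow> bool" where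
  "surface_thickness_ge c0 L0 \<gamma> F r \<longleftrightarrow>
     ereal r \<le> reach F \<and>
     (\<forall>x\<in>F - surface_boundary F. interior_graph c0 L0 r F x) \<and>
     (\<forall>x\<in>surface_boundary F. boundary_graph c0 L0 r F x) \<and>
     (\<exists>CF. collar_map c0 L0 r F CF \<and>
        (\<forall>s\<in>{0..c0 * r}. \<forall>p\<in>surface_boundary F.
           c0 * s \<le> infdist (CF (s, p)) (boundary_torus \<gamma>)) \<and>
        (\<forall>x\<in>F - CF ` ({0..c0 * r / 2} \<times> surface_boundary F).
           c0\<^sup>2 / 4 * r \<le> infdist x (boundary_torus \<gamma>)))"

section \<open>Essential surfaces\<close>

definition disk_param :: "pt set \<Rightarrow> (real ^ 2 \<Rightarrow> pt) \<Rightarrow> bool" where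
  "disk_param D f \<longleftrightarrow> (\<exists>f'. homeomorphism (cball 0 1) D f f')"

definition incompressible :: "pt set \<Rightarrow> pt set \<Rightarrow> bool" where
  "incompressible \<gamma> F \<longleftrightarrow>
     (\<forall>D f. disk_param D f \<and> D \<subseteq> finite_exterior \<gamma> \<and> D \<inter> F = f ` sphere 0 1 \<longrightarrow>
        (\<exists>D' f'. disk_param D' f' \<and> D' \<subseteq> F \<and> f' ` sphere 0 1 = f ` sphere 0 1))"

text \<open>The boundary of a boundary-compressing disk consists of an arc in \<open>F\<close> (the upper half
  circle) and an arc in \<open>T\<close> (the lower half circle).\<close>

definition boundary_incompressible :: "pt set \<Rightarrow> pt set \<Rightarrow> bool" where
  "boundary_incompressible \<gamma> F \<longleftrightarrow>
     (\<forall>D f. disk_param D f \<and> D \<subseteq> finite_exterior \<gamma> \<and>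
            D \<inter> F = f ` {z \<in> sphere 0 1. 0 \<le> z $ 2} \<and>
            D \<inter> boundary_torus \<gamma> = f ` {z \<in> sphere 0 1. z $ 2 \<le> 0} \<longrightarrow>
        (\<exists>D' f'. disk_param D' f' \<and> D' \<subseteq> F \<and> D \<inter> F \<subseteq> f' ` sphere 0 1 \<and>
            f' ` sphere 0 1 - D \<inter> F \<subseteq> surface_boundary F))"

definition product_region :: "pt set \<Rightarrow> pt set \<Rightarrow> (pt \<times> real \<Rightarrow> pt option) \<Rightarrow> bool" where
  "product_region \<gamma> F h \<longleftrightarrow>
     embedding_map (prod_topology (top_of_set F) (top_of_set {0..1})) S3 h \<and>
     h ` (F \<times> {0..1}) \<subseteq> exterior \<gamma> \<and> (\<forall>x\<in>F. h (x, 0) = Some x) \<and>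
     h ` (surface_boundary F \<times> {0..1}) \<subseteq> Some ` boundary_torus \<gamma>"

definition boundary_parallel :: "pt set \<Rightarrow> pt set \<Rightarrow> bool" where
  "boundary_parallel \<gamma> F \<longleftrightarrow>
     (\<exists>h. product_region \<gamma> F h \<and> h ` (F \<times> {1}) \<subseteq> Some ` boundary_torus \<gamma>)"

definition parallel_surfaces :: "pt set \<Rightarrow> pt set \<Rightarrow> pt set \<Rightarrow> bool" where
  "parallel_surfaces \<gamma> F F' \<longleftrightarrow> (\<exists>h. product_region \<gamma> F h \<and> h ` (F \<times> {1}) = Some ` F')"

definition bounds_ball :: "pt set \<Rightarrow> pt set \<Rightarrow> bool" where
  "bounds_ball \<gamma> F \<longleftrightarrow>
     (\<exists>h :: pt \<Rightarrow> pt option. embedding_map (top_of_set (cball 0 1)) S3 h \<and>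
        h ` cball 0 1 \<subseteq> exterior \<gamma> \<and> h ` sphere 0 1 = Some ` F)"

definition essential :: "pt set \<Rightarrow> pt set \<Rightarrow> bool" where
  "essential \<gamma> F \<longleftrightarrow>
     (\<forall>G\<in>components F. incompressible \<gamma> G \<and> boundary_incompressible \<gamma> G \<and>
        \<not> boundary_parallel \<gamma> G \<and>
        (G homeomorphic sphere (0::pt) 1 \<longrightarrow> \<not> bounds_ball \<gamma> G)) \<and>
     (\<forall>G\<in>components F. \<forall>G'\<in>components F. G \<noteq> G' \<longrightarrow> \<not> parallel_surfaces \<gamma> G G')"

section \<open>The encoding scheme\<close>

datatype code_symbol =
    Cube "int ^ 3"
  | Knot_Direction pt
  | Boundary_Direction pt
  | Normal_Line "pt set"
  | Sheet_Type nat
  | Incidence nat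
  | Adjacency bool
  | End_Boundary_Component
  | End_Layer

text \<open>All choices made to write down a raw word of a pair \<open>(crv, srf)\<close>: an arclength
  parametrisation \<open>(crv_param, crv_period)\<close> of the curve with the parameters \<open>crv_net\<close> of a net,
  a list of parametrised triangles, and for each boundary component an arclength parametrisation,
  its period, and the parameters of a net.\<close>

record discretization =
  crv :: "pt set"
  srf :: "pt set"
  crv_param :: "real \<Rightarrow> pt"
  crv_period :: real
  crv_net :: "real list"
  triangles :: "(pt \<Rightarrow> pt) list"
  bdry :: "((real \<Rightarrow> pt) \<times> real \<times> real list) list"

text \<open>The fixed universal data. The quantizers \<open>quant_*\<close> round to the direction nets (this also
  settles ties). The assignments of boundary-collar/sheet type symbols and of incidence symbols
  are arbitrary functions of \<open>\<tau>\<close>, \<open>\<epsilon>\<close>, the discretization and the indices of the cells; the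
  numbering of the alphabet may depend on \<open>\<Lambda>\<close>, \<open>\<Delta>\<close>, \<open>\<tau>\<close>, \<open>\<epsilon>\<close>, as the alphabet does.\<close>

record encoding_scheme =
  collar_const :: real                     \<comment> \<open>\<open>c\<^sub>0\<close>\<close>
  graph_const :: real                      \<comment> \<open>\<open>L\<^sub>0\<close>\<close>
  resolution_const :: real                 \<comment> \<open>\<open>c\<close>\<close>
  diam_const :: real                       \<comment> \<open>\<open>C\<^sub>d\<^sub>i\<^sub>a\<^sub>m\<close>\<close>
  knot_scale :: "real \<Rightarrow> real"             \<comment> \<open>\<open>\<delta>\<^sub>\<gamma>\<close> at resolution \<open>\<epsilon>\<close>\<close>
  knot_dirs :: "real \<Rightarrow> pt set"            \<comment> \<open>the net \<open>D\<^sub>\<gamma>\<close> at resolution \<open>\<epsilon>\<close>\<close>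
  quant_knot :: "real \<Rightarrow> pt \<Rightarrow> pt"
  surface_scale :: real                    \<comment> \<open>\<open>\<delta>\<^sub>F\<close>\<close>
  boundary_dirs :: "pt set"
  quant_boundary :: "pt \<Rightarrow> pt"
  normal_lines :: "pt set set"
  quant_normal :: "pt set \<Rightarrow> pt set"
  sheet_symbols :: "nat set"
  sheet_type :: "real \<Rightarrow> real \<Rightarrow> discretization \<Rightarrow> nat \<Rightarrow> nat"
  incidence_symbols :: "nat set"
  incidence_type :: "real \<Rightarrow> real \<Rightarrow> discretization \<Rightarrow> nat \<Rightarrow> nat \<Rightarrow> nat"
  shape_const :: real
  degree_bound :: nat
  curve_cell_const :: real
  surface_cell_const :: real
  numbering :: "real \<Rightarrow> real \<Rightarrow> real \<Rightarrow> real \<Rightarrow> code_symbol \<Rightarrow> nat"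

definition lattice_cube :: "real \<Rightarrow> int ^ 3 \<Rightarrow> pt set" where
  "lattice_cube \<epsilon> k =
     {x. \<forall>i. \<epsilon> * (of_int (k $ i) - 1/2) \<le> x $ i \<and> x $ i < \<epsilon> * (of_int (k $ i) + 1/2)}"

definition cube_of :: "real \<Rightarrow> pt \<Rightarrow> int ^ 3" where
  "cube_of \<epsilon> x = (THE k. x \<in> lattice_cube \<epsilon> k)"

definition neighbouring :: "int ^ 3 \<Rightarrow> int ^ 3 \<Rightarrow> bool" where
  "neighbouring k l \<longleftrightarrow> (\<forall>i. \<bar>k $ i - l $ i\<bar> \<le> 1)"

definition box_side :: "encoding_scheme \<Rightarrow> real \<Rightarrow> real \<Rightarrow> real \<Rightarrow> real" where
  "box_side \<S> \<Lambda> \<Delta> \<tau> = 2 * (\<Lambda> / 2 + 1 + diam_const \<S> * (\<Delta> / \<tau>))"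

definition cube_labels :: "encoding_scheme \<Rightarrow> real \<Rightarrow> real \<Rightarrow> real \<Rightarrow> real \<Rightarrow> (int ^ 3) set" where
  "cube_labels \<S> \<Lambda> \<Delta> \<tau> \<epsilon> =
     {k. lattice_cube \<epsilon> k \<inter> {x. \<forall>i. \<bar>x $ i\<bar> \<le> box_side \<S> \<Lambda> \<Delta> \<tau> / 2} \<noteq> {}}"

definition alphabet ::
    "encoding_scheme \<Rightarrow> real \<Rightarrow> real \<Rightarrow> real \<Rightarrow> real \<Rightarrow> code_symbol set" where
  "alphabet \<S> \<Lambda> \<Delta> \<tau> \<epsilon> =
     Cube ` cube_labels \<S> \<Lambda> \<Delta> \<tau> \<epsilon> \<union> Knot_Direction ` knot_dirs \<S> \<epsilon> \<union>
     Boundary_Direction ` boundary_dirs \<S> \<union> Normal_Line ` normal_lines \<S> \<union>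
     Sheet_Type ` sheet_symbols \<S> \<union> Incidence ` incidence_symbols \<S> \<union>
     range Adjacency \<union> {End_Boundary_Component, End_Layer}"

text \<open>\<open>\<real>P\<^sup>2\<close> is the set of antipodal pairs of unit vectors, with distance \<open>setdist\<close>.\<close>

definition RP2 :: "pt set set" where
  "RP2 = {{v, - v} | v. norm v = 1}"

definition valid_scheme :: "encoding_scheme \<Rightarrow> bool" where
  "valid_scheme \<S> \<longleftrightarrow>
     0 < collar_const \<S> \<and> collar_const \<S> < 1 \<and> 1 \<le> graph_const \<S> \<and>
     0 < resolution_const \<S> \<and> resolution_const \<S> \<le> 1 \<and>
     0 < diam_const \<S> \<and>
     (\<forall>\<gamma> F \<tau> \<Delta>. closed_curve \<gamma> \<and> 1 \<le> reach \<gamma> \<and> proper_surface \<gamma> F \<and> connected F \<and>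
        0 < \<tau> \<and> 0 < \<Delta> \<and> surface_thickness_ge (collar_const \<S>) (graph_const \<S>) \<gamma> F \<tau> \<and>
        area F \<le> ennreal \<Delta> \<longrightarrow> diameter F \<le> diam_const \<S> * (\<Delta> / \<tau>)) \<and>
     (\<forall>\<epsilon>\<in>{0<..1}. 0 < knot_scale \<S> \<epsilon> \<and> knot_scale \<S> \<epsilon> \<le> \<epsilon> \<and>
        finite (knot_dirs \<S> \<epsilon>) \<and> knot_dirs \<S> \<epsilon> \<subseteq> sphere 0 1 \<and>
        (\<forall>v\<in>sphere 0 1. quant_knot \<S> \<epsilon> v \<in> knot_dirs \<S> \<epsilon> \<and>
           dist v (quant_knot \<S> \<epsilon> v) \<le> knot_scale \<S> \<epsilon>)) \<and>
     (\<exists>M. \<forall>\<epsilon>\<in>{0<..1}. real (card (knot_dirs \<S> \<epsilon>)) \<le> M / \<epsilon>\<^sup>2) \<and>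
     0 < surface_scale \<S> \<and>
     finite (boundary_dirs \<S>) \<and> boundary_dirs \<S> \<subseteq> sphere 0 1 \<and>
     (\<forall>v\<in>sphere 0 1. quant_boundary \<S> v \<in> boundary_dirs \<S> \<and>
        dist v (quant_boundary \<S> v) \<le> surface_scale \<S>) \<and>
     finite (normal_lines \<S>) \<and> normal_lines \<S> \<subseteq> RP2 \<and>
     (\<forall>l\<in>RP2. quant_normal \<S> l \<in> normal_lines \<S> \<and>
        setdist l (quant_normal \<S> l) \<le> surface_scale \<S>) \<and>
     finite (sheet_symbols \<S>) \<and> (\<forall>\<tau> \<epsilon> d j. sheet_type \<S> \<tau> \<epsilon> d j \<in> sheet_symbols \<S>) \<and>
     finite (incidence_symbols \<S>) \<and>
     (\<forall>\<tau> \<epsilon> d i j. incidence_type \<S> \<tau> \<epsilon> d i j \<in> incidence_symbols \<S>) \<and>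
     1 \<le> shape_const \<S> \<and> 0 < curve_cell_const \<S> \<and> 0 < surface_cell_const \<S> \<and>
     (\<forall>\<Lambda>>0. \<forall>\<Delta>>0. \<forall>\<tau>>0. \<forall>\<epsilon>>0. inj_on (numbering \<S> \<Lambda> \<Delta> \<tau> \<epsilon>) (alphabet \<S> \<Lambda> \<Delta> \<tau> \<epsilon>))"

subsection \<open>Admissible discretizations\<close>

text \<open>The parameters of a \<open>\<delta>\<close>-net of \<open>A\<close>, that is, a \<open>\<delta>\<close>-separated and \<open>\<delta>\<close>-dense subset, listed
  in the cyclic order and from the basepoint given by \<open>g\<close>.\<close>

definition arclength_net :: "(real \<Rightarrow> pt) \<Rightarrow> real \<Rightarrow> pt set \<Rightarrow> real \<Rightarrow> real list \<Rightarrow> bool" where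
  "arclength_net g L A \<delta> ts \<longleftrightarrow>
     sorted_wrt (<) ts \<and> set ts \<subseteq> {0..<L} \<and>
     (\<forall>s\<in>set ts. \<forall>t\<in>set ts. s \<noteq> t \<longrightarrow> \<delta> \<le> arclength_dist A (g s) (g t)) \<and>
     (\<forall>x\<in>A. \<exists>t\<in>set ts. arclength_dist A x (g t) \<le> \<delta>)"

definition simplex_face :: "3 set \<Rightarrow> pt set" where
  "simplex_face I = {x. (\<forall>i. 0 \<le> x $ i) \<and> (\<Sum>i\<in>UNIV. x $ i) = 1 \<and> (\<forall>i. i \<notin> I \<longrightarrow> x $ i = 0)}"

abbreviation std_triangle :: "pt set" where
  "std_triangle \<equiv> simplex_face UNIV"

text \<open>Two triangles meet in a common edge, a common vertex, or not at all (the face of the empty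
  set is empty).\<close>

definition triangulation ::
    "encoding_scheme \<Rightarrow> real \<Rightarrow> pt set \<Rightarrow> (pt \<Rightarrow> pt) list \<Rightarrow> bool" where
  "triangulation \<S> \<epsilon> F \<phi>s \<longleftrightarrow>
     (\<Union>\<phi>\<in>set \<phi>s. \<phi> ` std_triangle) = F \<and>
     (\<forall>i<length \<phi>s. \<forall>j<length \<phi>s. i \<noteq> j \<longrightarrow>
        (\<exists>I J. I \<noteq> UNIV \<and> J \<noteq> UNIV \<and>
           (\<phi>s ! i) ` std_triangle \<inter> (\<phi>s ! j) ` std_triangle = (\<phi>s ! i) ` simplex_face I \<and>
           (\<phi>s ! i) ` simplex_face I = (\<phi>s ! j) ` simplex_face J)) \<and>
     (\<forall>\<phi>\<in>set \<phi>s. diameter (\<phi> ` std_triangle) \<le> \<epsilon> \<and>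
        (\<exists>l>0. \<forall>x\<in>std_triangle. \<forall>y\<in>std_triangle.
           l / shape_const \<S> * dist x y \<le> dist (\<phi> x) (\<phi> y) \<and>
           dist (\<phi> x) (\<phi> y) \<le> shape_const \<S> * l * dist x y)) \<and>
     (\<forall>\<phi>\<in>set \<phi>s. \<forall>k. card {j. j < length \<phi>s \<and> \<phi> (axis k 1) \<in> (\<phi>s ! j) ` std_triangle}
        \<le> degree_bound \<S>)"

definition edge_adjacent :: "(pt \<Rightarrow> pt) \<Rightarrow> (pt \<Rightarrow> pt) \<Rightarrow> bool" where
  "edge_adjacent \<phi> \<psi> \<longleftrightarrow>
     (\<exists>I. card I = 2 \<and> \<phi> ` std_triangle \<inter> \<psi> ` std_triangle = \<phi> ` simplex_face I)"

definition triangle_barycenter :: "(pt \<Rightarrow> pt) \<Rightarrow> pt" where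
  "triangle_barycenter \<phi> = \<phi> (\<chi> i. 1/3)"

definition normal_line :: "pt set \<Rightarrow> pt \<Rightarrow> pt set" where
  "normal_line F x = {n. norm n = 1 \<and> (\<forall>v\<in>tangent_space F x. n \<bullet> v = 0)}"

definition admissible :: "encoding_scheme \<Rightarrow> real \<Rightarrow> discretization \<Rightarrow> bool" where
  "admissible \<S> \<epsilon> d \<longleftrightarrow>
     unit_speed (crv_param d) (crv_period d) (crv d) \<and>
     \<comment> \<open>rigid normalization: the barycenter of the curve is the origin\<close>
     (1 / crv_period d) *\<^sub>R integral {0..crv_period d} (crv_param d) = 0 \<and>
     arclength_net (crv_param d) (crv_period d) (crv d) (\<epsilon> / 2) (crv_net d) \<and>
     triangulation \<S> \<epsilon> (srf d) (triangles d) \<and>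
     distinct (map (\<lambda>(g, L, ts). range g) (bdry d)) \<and>
     (\<lambda>(g, L, ts). range g) ` set (bdry d) = components (surface_boundary (srf d)) \<and>
     (\<forall>(g, L, ts)\<in>set (bdry d). unit_speed g L (range g) \<and>
        arclength_net g L (range g) (\<epsilon> / 2) ts) \<and>
     real (length (crv_net d)) \<le> curve_cell_const \<S> * (curve_length (crv d) / \<epsilon>) \<and>
     ennreal (real (length (triangles d))) \<le>
       ennreal (surface_cell_const \<S> / \<epsilon>\<^sup>2) * area (srf d)"

subsection \<open>Raw words and encoded types\<close>

definition curve_layer :: "encoding_scheme \<Rightarrow> real \<Rightarrow> discretization \<Rightarrow> code_symbol list" where
  "curve_layer \<S> \<epsilon> d =
     concat (map (\<lambda>t. [Cube (cube_of \<epsilon> (crv_param d t)),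
        Knot_Direction (quant_knot \<S> \<epsilon> (vector_derivative (crv_param d) (at t)))]) (crv_net d))"

definition triangle_layer ::
    "encoding_scheme \<Rightarrow> real \<Rightarrow> real \<Rightarrow> discretization \<Rightarrow> code_symbol list" where
  "triangle_layer \<S> \<tau> \<epsilon> d =
     concat (map (\<lambda>j. let b = triangle_barycenter (triangles d ! j) in
       [Cube (cube_of \<epsilon> b), Normal_Line (quant_normal \<S> (normal_line (srf d) b)),
        Sheet_Type (sheet_type \<S> \<tau> \<epsilon> d j)]) [0..<length (triangles d)])"

definition adjacency_layer :: "discretization \<Rightarrow> code_symbol list" where
  "adjacency_layer d =
     concat (map (\<lambda>i. map (\<lambda>j. Adjacency (edge_adjacent (triangles d ! i) (triangles d ! j)))
       [0..<i]) [0..<length (triangles d)])"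

definition boundary_layer :: "encoding_scheme \<Rightarrow> real \<Rightarrow> discretization \<Rightarrow> code_symbol list" where
  "boundary_layer \<S> \<epsilon> d =
     concat (map (\<lambda>(g, L, ts).
       concat (map (\<lambda>t. [Cube (cube_of \<epsilon> (g t)),
          Boundary_Direction (quant_boundary \<S> (vector_derivative g (at t)))]) ts)
       @ [End_Boundary_Component]) (bdry d))"

text \<open>The \<open>i\<close>-th curve edge joins the \<open>i\<close>-th sample to its cyclic successor. It is near a triangle
  if the cube of one of its end points equals or neighbours the cube of the triangle.\<close>

definition near :: "real \<Rightarrow> discretization \<Rightarrow> nat \<Rightarrow> nat \<Rightarrow> bool" where
  "near \<epsilon> d i j \<longleftrightarrow>
     (\<exists>k\<in>{i, Suc i mod length (crv_net d)}.
        neighbouring (cube_of \<epsilon> (crv_param d (crv_net d ! k)))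
          (cube_of \<epsilon> (triangle_barycenter (triangles d ! j))))"

definition position_layer ::
    "encoding_scheme \<Rightarrow> real \<Rightarrow> real \<Rightarrow> discretization \<Rightarrow> code_symbol list" where
  "position_layer \<S> \<tau> \<epsilon> d =
     concat (map (\<lambda>i. map (\<lambda>j. Incidence (incidence_type \<S> \<tau> \<epsilon> d i j))
       (filter (near \<epsilon> d i) [0..<length (triangles d)])) [0..<length (crv_net d)])"

definition raw_word ::
    "encoding_scheme \<Rightarrow> real \<Rightarrow> real \<Rightarrow> discretization \<Rightarrow> code_symbol list" where
  "raw_word \<S> \<tau> \<epsilon> d =
     curve_layer \<S> \<epsilon> d @ [End_Layer] @ triangle_layer \<S> \<tau> \<epsilon> d @ [End_Layer] @
     adjacency_layer d @ [End_Layer] @ boundary_layer \<S> \<epsilon> d @ [End_Layer] @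
     position_layer \<S> \<tau> \<epsilon> d"

definition essential_pairs ::
    "encoding_scheme \<Rightarrow> pt set set \<Rightarrow> real \<Rightarrow> real \<Rightarrow> real \<Rightarrow> (pt set \<times> pt set) set" where
  "essential_pairs \<S> K \<Lambda> \<Delta> \<tau> =
     {(\<gamma>, F). \<gamma> \<in> K \<and> reach \<gamma> = 1 \<and> curve_length \<gamma> \<le> \<Lambda> \<and>
        proper_surface \<gamma> F \<and> essential \<gamma> F \<and>
        surface_thickness_ge (collar_const \<S>) (graph_const \<S>) \<gamma> F \<tau> \<and> area F \<le> ennreal \<Delta>}"

definition rigid_equiv :: "((pt set \<times> pt set) \<times> (pt set \<times> pt set)) set" where
  "rigid_equiv =
     {((\<gamma>, F), (\<gamma>', F')). \<exists>A b. orthogonal_matrix A \<and> det A = 1 \<and>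
        \<gamma>' = (\<lambda>x. A *v x + b) ` \<gamma> \<and> F' = (\<lambda>x. A *v x + b) ` F}"

definition Z_ess ::
    "encoding_scheme \<Rightarrow> pt set set \<Rightarrow> real \<Rightarrow> real \<Rightarrow> real \<Rightarrow> (pt set \<times> pt set) set set" where
  "Z_ess \<S> K \<Lambda> \<Delta> \<tau> =
     (let X = essential_pairs \<S> K \<Lambda> \<Delta> \<tau> in X // (rigid_equiv \<inter> X \<times> X))"

text \<open>The raw words of a class \<open>P\<close> of pairs modulo rigid motions. Choosing a rigid normalization
  amounts to choosing a member of \<open>P\<close> whose curve has its barycenter at the origin.\<close>

definition raw_words ::
    "encoding_scheme \<Rightarrow> real \<Rightarrow> real \<Rightarrow> real \<Rightarrow> real \<Rightarrow> (pt set \<times> pt set) set \<Rightarrow>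
     code_symbol list set" where
  "raw_words \<S> \<Lambda> \<Delta> \<tau> \<epsilon> P =
     {raw_word \<S> \<tau> \<epsilon> d | d. (crv d, srf d) \<in> P \<and> admissible \<S> \<epsilon> d \<and>
        set (raw_word \<S> \<tau> \<epsilon> d) \<subseteq> alphabet \<S> \<Lambda> \<Delta> \<tau> \<epsilon>}"

text \<open>\<open>lenlex\<close> is the shortlex order.\<close>

definition is_encoded_type ::
    "encoding_scheme \<Rightarrow> real \<Rightarrow> real \<Rightarrow> real \<Rightarrow> real \<Rightarrow> (pt set \<times> pt set) set \<Rightarrow>
     code_symbol list \<Rightarrow> bool" where
  "is_encoded_type \<S> \<Lambda> \<Delta> \<tau> \<epsilon> P w \<longleftrightarrow>
     w \<in> raw_words \<S> \<Lambda> \<Delta> \<tau> \<epsilon> P \<and>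
     (\<forall>w'\<in>raw_words \<S> \<Lambda> \<Delta> \<tau> \<epsilon> P. w' \<noteq> w \<longrightarrow>
        (map (numbering \<S> \<Lambda> \<Delta> \<tau> \<epsilon>) w, map (numbering \<S> \<Lambda> \<Delta> \<tau> \<epsilon>) w') \<in> lenlex less_than)"

definition encoded_types ::
    "encoding_scheme \<Rightarrow> pt set set \<Rightarrow> real \<Rightarrow> real \<Rightarrow> real \<Rightarrow> real \<Rightarrow> code_symbol list set" where
  "encoded_types \<S> K \<Lambda> \<Delta> \<tau> \<epsilon> =
     {w. \<exists>P\<in>Z_ess \<S> K \<Lambda> \<Delta> \<tau>. is_encoded_type \<S> \<Lambda> \<Delta> \<tau> \<epsilon> P w}"

end

theory Submission
  imports Defs
begin

text \<open>
  The encoded types are words of length \<open>O(N\<^sup>2)\<close> over an alphabet of \<open>O(N\<^sup>3)\<close> symbols. For the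
  length, the only layer that is not bounded by the admissibility conditions is the boundary layer.
  By the collar estimates, all boundary samples are pairwise at distance at least a fixed multiple
  of \<open>\<epsilon>\<close>; since the triangles cover the surface and have diameter at most \<open>\<epsilon>\<close>, there are
  boundedly many samples in each of the \<open>O(\<Delta>/\<epsilon>\<^sup>2)\<close> triangles. For the alphabet, the additive constant
  in the side of the box contributes \<open>1/\<epsilon>\<close>, which is \<open>O(\<Lambda>/\<epsilon>)\<close> because a closed curve of reach \<open>1\<close>
  has length at least \<open>1/2\<close>.
\<close>

section \<open>Length of a closed curve of reach one\<close>

text \<open>The retraction is the nearest point map. Since \<open>A\<close> is compact, its
  continuity follows once its graph is closed in \<open>S \<times> A\<close>.\<close>

lemma unique_nearest_point_imp_retract:
  fixes A S :: "'a::euclidean_space set"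
  assumes "compact A" "A \<subseteq> S"
    and uniq: "\<And>x. x \<in> S \<Longrightarrow> \<exists>!a. a \<in> A \<and> (\<forall>b\<in>A. dist x a \<le> dist x b)"
  shows "A retract_of S"
proof -
  define r where "r x = (THE a. a \<in> A \<and> (\<forall>b\<in>A. dist x a \<le> dist x b))" for x
  have r: "r x \<in> A \<and> (\<forall>b\<in>A. dist x (r x) \<le> dist x b)" if "x \<in> S" for x
    unfolding r_def by (rule theI' [OF uniq [OF that]])
  have r_eq: "r x = a" if "x \<in> S" "a \<in> A" "\<forall>b\<in>A. dist x a \<le> dist x b" for x a
    using uniq [OF that(1)] r [OF that(1)] that(2,3) by blast
  \<comment> \<open>Uniqueness enters here: a pair satisfying all the distance inequalities must lie
    on the graph, so the graph is cut out by closed conditions.\<close>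
  have graph: "(\<lambda>x. (x, r x)) ` S = S \<times> A \<inter> (\<Inter>b\<in>A. {z. dist (fst z) (snd z) \<le> dist (fst z) b})"
    using r r_eq by (force simp: image_iff)
  have "closed (\<Inter>b\<in>A. {z :: 'a \<times> 'a. dist (fst z) (snd z) \<le> dist (fst z) b})"
    by (intro closed_INT ballI closed_Collect_le continuous_intros)
  then have "closedin (top_of_set (S \<times> A)) ((\<lambda>x. (x, r x)) ` S)"
    unfolding graph by (simp add: closedin_closed_Int)
  moreover have "r \<in> S \<rightarrow> A"
    using r by blast
  ultimately have "continuous_on S r"
    by (subst continuous_closed_graph_eq [OF \<open>compact A\<close>])
  moreover have "r a = a" if "a \<in> A" for a
    using that \<open>A \<subseteq> S\<close> by (intro r_eq) auto
  ultimately have "retraction S A r"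
    using \<open>A \<subseteq> S\<close> \<open>r \<in> S \<rightarrow> A\<close> by (simp add: retraction_def)
  then show ?thesis
    by (auto simp: retract_of_def)
qed

section \<open>Arclength parametrisations of closed curves\<close>

context
  fixes g :: "real \<Rightarrow> pt" and L :: real and A :: "pt set"
  assumes us: "unit_speed g L A"
begin

text \<open>Subtracting \<open>\<lfloor>t / L\<rfloor>\<close> periods moves a parameter
  \<open>t\<close> into the fundamental interval.\<close>

lemma unit_speed_image_atLeastLessThan: "g ` {0..<L} = A"
proof -
  have L: "0 < L" and per: "\<And>t. g (t + L) = g t" and A: "range g = A"
    using us by (auto simp: unit_speed_def)
  interpret periodic_fun_simple g L
    by unfold_locales (rule per)
  have "g t \<in> g ` {0..<L}" for t
  proof (rule image_eqI)
    have "real_of_int \<lfloor>t / L\<rfloor> * L \<le> t"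
      using L by (simp flip: pos_le_divide_eq)
    moreover have "t < (real_of_int \<lfloor>t / L\<rfloor> + 1) * L"
      using L by (simp flip: pos_divide_less_eq)
    ultimately show "t - of_int \<lfloor>t / L\<rfloor> * L \<in> {0..<L}"
      by (simp add: algebra_simps)
    show "g t = g (t - of_int \<lfloor>t / L\<rfloor> * L)"
      by (rule minus_of_int [symmetric])
  qed
  then show ?thesis
    using A by blast
qed

lemma unit_speed_dist_le: "dist (g s) (g t) \<le> \<bar>s - t\<bar>"
proof -
  obtain g' where g': "\<And>t. (g has_vector_derivative g' t) (at t)" "\<And>t. norm (g' t) = 1"
    using us by (auto simp: unit_speed_def)
  have "norm (g s - g t) \<le> 1 * norm (s - t)"
  proof (rule differentiable_bound [where S = UNIV and f' = "\<lambda>t x. x *\<^sub>R g' t"])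
    show "(g has_derivative (\<lambda>x. x *\<^sub>R g' t)) (at t within UNIV)" for t
      using g'(1) by (simp add: has_vector_derivative_def)
    show "onorm (\<lambda>x. x *\<^sub>R g' t) \<le> 1" for t
      by (rule onorm_le) (simp add: g'(2))
  qed auto
  then show ?thesis
    by (simp add: dist_norm)
qed

lemma unit_speed_continuous: "continuous_on S g"
proof (rule lipschitz_on_continuous_on)
  show "1-lipschitz_on S g"
    using unit_speed_dist_le by (intro lipschitz_onI) (simp_all add: dist_real_def)
qed

text \<open>Rescaling one period to the unit interval gives a simple closed path, whose image is a
  circle.\<close>

lemma unit_speed_homeomorphic_circle: "A homeomorphic sphere (0::complex) 1"
proof -
  have L: "0 < L" and inj: "inj_on g {0..<L}" and gL: "g L = g 0"
    using us by (auto simp: unit_speed_def dest!: spec [of _ 0])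
  let ?p = "\<lambda>x. g (L * x)"
  have "path ?p"
    unfolding path_def
    by (rule continuous_on_compose2 [OF unit_speed_continuous [of UNIV]])
       (auto intro!: continuous_intros)
  moreover have "loop_free ?p"
  proof -
    have eq: "x = y" if "g (L * x) = g (L * y)" "x \<in> {0..<1}" "y \<in> {0..<1}" for x y
      using inj_onD [OF inj that(1)] that(2,3) L by auto
    \<comment> \<open>Injectivity is known only on the half-open interval, so the end point 1 is
      traded for the parameter 0.\<close>
    have "g L = g (L * 0)"
      using gL by simp
    then have "x = 0" if "g (L * x) = g L" "x \<in> {0..<1}" for x
      using eq [of x 0] that by auto
    then show ?thesis
      unfolding loop_free_def using eq
      by (metis atLeastAtMost_iff atLeastLessThan_iff less_eq_real_def mult.right_neutral)
  qed
  moreover have "path_image ?p = A"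
  proof -
    have "path_image ?p = g ` ((\<lambda>x. L * x) ` {0..1})"
      by (simp add: path_image_def image_image)
    also have "(\<lambda>x. L * x) ` {0..1} = {0..L}"
      using L by (simp add: image_mult_atLeastAtMost)
    also have "{0..L} = insert L {0..<L}"
      using L by auto
    also have "g ` \<dots> = A"
      using unit_speed_image_atLeastLessThan gL L by auto
    finally show ?thesis .
  qed
  ultimately show ?thesis
    using homeomorphic_simple_path_image_circle [of ?p 1 0] gL
    by (simp add: simple_path_def pathfinish_def pathstart_def)
qed

text \<open>A shorter curve lies in a ball on which the nearest point retraction onto it is defined,
  but the circle is not contractible.\<close>

lemma unit_speed_reach_one_imp_length_ge:
  assumes "reach A = 1"
  shows "1 / 2 \<le> L"
proof (rule ccontr)
  assume short: "\<not> 1 / 2 \<le> L"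
  \<comment> \<open>The supremum defining the reach need not be attained, so the uniqueness property
    is taken at some radius strictly between 1/2 and infinity.\<close>
  have "ereal (1 / 2) < (SUP r\<in>{r. 0 \<le> r \<and> reach_at_least A r}. ereal r)"
    using assms by (simp add: reach_def one_ereal_def)
  then obtain r where r: "1 / 2 < r" "reach_at_least A r"
    by (auto simp: less_SUP_iff)
  have "g 0 \<in> A"
    using us by (auto simp: unit_speed_def)
  \<comment> \<open>Every point has a parameter below \<open>L < 1 / 2\<close>, and distance is at
    most the difference of parameters.\<close>
  have "A \<subseteq> ball (g 0) (1 / 2)"
  proof
    fix a assume "a \<in> A"
    then obtain t where t: "a = g t" "t \<in> {0..<L}"
      using unit_speed_image_atLeastLessThan by blast
    show "a \<in> ball (g 0) (1 / 2)"
      using unit_speed_dist_le [of 0 t] t short by auto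
  qed
  moreover have "compact A"
    using homeomorphic_compactness [OF unit_speed_homeomorphic_circle] by simp
  moreover have "\<exists>!a. a \<in> A \<and> (\<forall>b\<in>A. dist x a \<le> dist x b)" if "x \<in> ball (g 0) (1 / 2)" for x
  proof -
    have "dist x (g 0) < r"
      using that r(1) by (simp add: dist_commute)
    then show ?thesis
      using r(2) \<open>g 0 \<in> A\<close> unfolding reach_at_least_def by blast
  qed
  ultimately have "A retract_of ball (g 0) (1 / 2)"
    by (intro unique_nearest_point_imp_retract)
  then have "contractible A"
    using retract_of_contractible convex_imp_contractible convex_ball by blast
  then show False
    using homeomorphic_contractible_eq [OF unit_speed_homeomorphic_circle]
    by (simp add: contractible_sphere)
qed

end

text \<open>Every period is at least 1/2, and a closed curve has one, so the infimum is over a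
  nonempty set.\<close>

lemma curve_length_ge:
  assumes "closed_curve \<gamma>" "reach \<gamma> = 1"
  shows "1 / 2 \<le> curve_length \<gamma>"
  unfolding curve_length_def
  using assms unit_speed_reach_one_imp_length_ge
  by (intro cInf_greatest) (auto simp: closed_curve_def)

section \<open>Boundary samples\<close>

text \<open>A packing bound that is uniform in centre and scale: after rescaling to the unit ball,
  separated points lie in different members of one finite cover by balls of radius
  \<open>\<eta> / 2\<close>.\<close>

lemma separated_subset_cball_card_le:
  fixes \<eta> :: real
  assumes "0 < \<eta>"
  obtains m :: nat where
    "\<And>(x::'a::euclidean_space) \<epsilon> S. 0 < \<epsilon> \<Longrightarrow> S \<subseteq> cball x \<epsilon> \<Longrightarrow>
       (\<forall>p\<in>S. \<forall>q\<in>S. p \<noteq> q \<longrightarrow> \<eta> * \<epsilon> \<le> dist p q) \<Longrightarrow> card S \<le> m"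
proof -
  obtain C :: "'a set" where C: "finite C" "cball 0 1 \<subseteq> (\<Union>c\<in>C. ball c (\<eta> / 2))"
    using compact_eq_totally_bounded [of "cball (0::'a) 1"] assms
    by (auto dest!: spec [of _ "\<eta> / 2"])
  have "card S \<le> card C"
    if \<epsilon>: "0 < \<epsilon>" and S: "S \<subseteq> cball x \<epsilon>"
      and sep: "\<forall>p\<in>S. \<forall>q\<in>S. p \<noteq> q \<longrightarrow> \<eta> * \<epsilon> \<le> dist p q" for x :: 'a and \<epsilon> S
  proof -
    let ?s = "\<lambda>p. (1 / \<epsilon>) *\<^sub>R (p - x)"
    have "\<exists>c\<in>C. ?s p \<in> ball c (\<eta> / 2)" if "p \<in> S" for p
    proof -
      have "?s p \<in> cball 0 1"
        using S \<epsilon> that by (auto simp: dist_norm norm_minus_commute)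
      then show ?thesis
        using C(2) by blast
    qed
    then obtain f where f: "\<And>p. p \<in> S \<Longrightarrow> f p \<in> C \<and> ?s p \<in> ball (f p) (\<eta> / 2)"
      by metis
    have "inj_on f S"
    proof (rule inj_onI, rule ccontr)
      fix p q assume pq: "p \<in> S" "q \<in> S" "f p = f q" "p \<noteq> q"
      have "dist (?s p) (?s q) < \<eta>"
      proof (rule dist_triangle_half_r)
        show "dist (f p) (?s p) < \<eta> / 2" "dist (f p) (?s q) < \<eta> / 2"
          using f [OF pq(1)] f [OF pq(2)] by (simp_all only: mem_ball pq(3))
      qed
      also have "dist (?s p) (?s q) = dist p q / \<epsilon>"
        using \<epsilon> by (simp add: dist_norm flip: scaleR_diff_right)
      finally show False
        using sep pq \<epsilon> by (force simp: field_simps)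
    qed
    then show ?thesis
      using f C(1) by (intro card_inj_on_le) auto
  qed
  then show thesis
    using that by blast
qed

text \<open>Points instead of parameters, so that the samples of all components can be counted
  together inside the triangles.\<close>

definition boundary_samples :: "discretization \<Rightarrow> pt set" where
  "boundary_samples d = (\<Union>(g, L, ts)\<in>set (bdry d). g ` set ts)"

section \<open>Boundary samples of an admissible discretization\<close>

context
  fixes \<S> :: encoding_scheme and \<epsilon> :: real and d :: discretization
  assumes adm: "admissible \<S> \<epsilon> d"
begin

lemma bdry_components:
  assumes "(g, L, ts) \<in> set (bdry d)"
  shows "range g \<in> components (surface_boundary (srf d))" "unit_speed g L (range g)"
    "arclength_net g L (range g) (\<epsilon> / 2) ts"
proof -
  have "(\<lambda>(g, L, ts). range g) ` set (bdry d) = components (surface_boundary (srf d))"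
    "\<forall>(g, L, ts)\<in>set (bdry d). unit_speed g L (range g) \<and> arclength_net g L (range g) (\<epsilon> / 2) ts"
    using adm by (simp_all add: admissible_def)
  then show "range g \<in> components (surface_boundary (srf d))" "unit_speed g L (range g)"
    "arclength_net g L (range g) (\<epsilon> / 2) ts"
    using assms by (blast, fast, fast)
qed

text \<open>Used to conclude that two samples on the same component come from the same
  parametrisation and the same net.\<close>

lemma bdry_unique:
  assumes "(g, L, ts) \<in> set (bdry d)" "(g', L', ts') \<in> set (bdry d)" "range g = range g'"
  shows "(g, L, ts) = (g', L', ts')"
proof -
  have "inj_on (\<lambda>(g, L, ts). range g) (set (bdry d))"
    using adm by (simp add: admissible_def distinct_map)
  from inj_onD [OF this _ assms(1,2)] assms(3) show ?thesis
    by simp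
qed

text \<open>Samples on one component are separated in arclength, hence in space by the lower collar
  estimate; different components are far apart.\<close>

lemma boundary_samples_separated:
  assumes thick: "surface_thickness_ge c0 L0 \<gamma> (srf d) \<tau>"
    and "0 < c0" "1 \<le> L0" "0 < \<epsilon>" "\<epsilon> \<le> \<tau>"
    and pq: "p \<in> boundary_samples d" "q \<in> boundary_samples d" "p \<noteq> q"
  shows "min c0 (1 / (2 * L0)) * \<epsilon> \<le> dist p q"
proof -
  from pq obtain g L ts s h M us t where
    p: "(g, L, ts) \<in> set (bdry d)" "s \<in> set ts" "p = g s" and
    q: "(h, M, us) \<in> set (bdry d)" "t \<in> set us" "q = h t"
    by (force simp: boundary_samples_def)
  note Cp = bdry_components [OF p(1)] and Cq = bdry_components [OF q(1)]
  have bd: "p \<in> surface_boundary (srf d)" "q \<in> surface_boundary (srf d)"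
    using Cp(1) Cq(1) p q in_components_subset by blast+
  have range: "p \<in> range g" "q \<in> range h"
    using p q by auto
  \<comment> \<open>The collar estimates are applied at height 0, where the collar map fixes the
    boundary.\<close>
  have zero: "0 \<in> {0..c0 * \<tau>}"
    using assms by simp
  obtain CF where CF: "collar_map c0 L0 \<tau> (srf d) CF"
    using thick by (auto simp: surface_thickness_ge_def)
  then have CF0: "CF (0, p) = p" "CF (0, q) = q"
    using bd by (auto simp: collar_map_def Let_def)
  let ?I = "{0..c0 * \<tau>}" and ?K = "components (surface_boundary (srf d))"
  have lower: "\<forall>\<beta>\<in>?K. \<forall>p\<in>\<beta>. \<forall>q\<in>\<beta>. \<forall>s\<in>?I. \<forall>t\<in>?I.
      min \<tau> (\<bar>s - t\<bar> + arclength_dist \<beta> p q) / L0 \<le> dist (CF (s, p)) (CF (t, q))"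
    using CF by (simp add: collar_map_def Let_def)
  have apart: "\<forall>\<beta>\<in>?K. \<forall>\<beta>'\<in>?K. \<beta> \<noteq> \<beta>' \<longrightarrow> (\<forall>p\<in>\<beta>. \<forall>q\<in>\<beta>'. \<forall>s\<in>?I. \<forall>t\<in>?I.
      c0 * \<tau> \<le> dist (CF (s, p)) (CF (t, q)))"
    using CF by (simp add: collar_map_def Let_def)
  \<comment> \<open>Each term of the minimum serves one case. On one component the net is
    \<open>\<epsilon> / 2\<close>-separated and \<epsilon> \<le> \<tau> makes the truncation at
    \<tau> harmless; different components are at distance at least
    \<open>c0 * \<tau>\<close>.\<close>
  show ?thesis
  proof (cases "range g = range h")
    case True
    with bdry_unique [OF p(1) q(1)] have [simp]: "h = g" "us = ts"
      by auto
    have "s \<noteq> t"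
      using pq p q by auto
    then have "\<epsilon> / 2 \<le> arclength_dist (range g) p q"
      using Cp(3) p q by (simp add: arclength_net_def)
    then have "(\<epsilon> / 2) / L0 \<le> min \<tau> (\<bar>0 - 0\<bar> + arclength_dist (range g) p q) / L0"
      using assms by (intro divide_right_mono) auto
    also have "\<dots> \<le> dist (CF (0, p)) (CF (0, q))"
      using lower [rule_format, OF Cp(1) range(1) _ zero zero] range(2) by simp
    finally have "1 / (2 * L0) * \<epsilon> \<le> dist p q"
      by (simp add: CF0)
    moreover have "min c0 (1 / (2 * L0)) * \<epsilon> \<le> 1 / (2 * L0) * \<epsilon>"
      using \<open>0 < \<epsilon>\<close> by (intro mult_right_mono) auto
    ultimately show ?thesis
      by linarith
  next
    case False
    have "c0 * \<tau> \<le> dist (CF (0, p)) (CF (0, q))"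
      by (rule apart [rule_format, OF Cp(1) Cq(1) False range zero zero])
    then have "c0 * \<tau> \<le> dist p q"
      by (simp add: CF0)
    moreover have "min c0 (1 / (2 * L0)) * \<epsilon> \<le> c0 * \<tau>"
      using assms by (intro mult_mono) auto
    ultimately show ?thesis
      by linarith
  qed
qed

lemma boundary_samples_subset: "boundary_samples d \<subseteq> (\<Union>\<phi>\<in>set (triangles d). \<phi> ` std_triangle)"
proof -
  have "range g \<subseteq> srf d" if "(g, L, ts) \<in> set (bdry d)" for g L ts
    using in_components_subset [OF bdry_components(1) [OF that]]
    by (auto simp: surface_boundary_def)
  then have "boundary_samples d \<subseteq> srf d"
    unfolding boundary_samples_def by blast
  then show ?thesis
    using adm by (simp add: admissible_def triangulation_def)
qed

text \<open>The parameters increase strictly within one period, on which \<open>g\<close> is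
  injective, so no two samples coincide.\<close>

lemma bdry_net_distinct:
  assumes "(g, L, ts) \<in> set (bdry d)"
  shows "card (g ` set ts) = length ts"
proof -
  have "inj_on g {0..<L}" "set ts \<subseteq> {0..<L}" "sorted_wrt (<) ts"
    using bdry_components [OF assms] by (auto simp: unit_speed_def arclength_net_def)
  then show ?thesis
    by (simp add: card_image inj_on_subset distinct_card strict_sorted_iff)
qed

text \<open>A net is dense in a nonempty curve. This pays for the end marker of each component
  below.\<close>

lemma bdry_net_nonempty:
  assumes "(g, L, ts) \<in> set (bdry d)"
  shows "ts \<noteq> []"
  using bdry_components(3) [OF assms] by (auto simp: arclength_net_def)

text \<open>Different components are disjoint, so the numbers of their samples add up.\<close>

lemma sum_length_bdry_nets:
  "sum_list (map (\<lambda>(g, L, ts). length ts) (bdry d)) = card (boundary_samples d)"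
proof -
  have "distinct (bdry d)"
    using adm by (simp add: admissible_def distinct_map)
  then have "sum_list (map (\<lambda>(g, L, ts). length ts) (bdry d)) =
      (\<Sum>(g, L, ts)\<in>set (bdry d). length ts)"
    by (simp add: sum_list_distinct_conv_sum_set)
  also have "\<dots> = (\<Sum>x\<in>set (bdry d). card (case x of (g, L, ts) \<Rightarrow> g ` set ts))"
    by (rule sum.cong) (auto simp: bdry_net_distinct)
  also have "\<dots> = card (boundary_samples d)"
    unfolding boundary_samples_def
  proof (rule card_UN_disjoint [symmetric])
    show "\<forall>x\<in>set (bdry d). \<forall>y\<in>set (bdry d). x \<noteq> y \<longrightarrow>
      (case x of (g, L, ts) \<Rightarrow> g ` set ts) \<inter> (case y of (g, L, ts) \<Rightarrow> g ` set ts) = {}"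
    proof (intro ballI impI)
      fix x y
      assume xy: "x \<in> set (bdry d)" "y \<in> set (bdry d)" "x \<noteq> y"
      obtain g L ts h M us where [simp]: "x = (g, L, ts)" "y = (h, M, us)"
        by (cases x, cases y)
      have *: "(g, L, ts) \<in> set (bdry d)" "(h, M, us) \<in> set (bdry d)"
        "(g, L, ts) \<noteq> (h, M, us)"
        using xy by simp_all
      then have "range g \<noteq> range h"
        using bdry_unique by blast
      then have "range g \<inter> range h = {}"
        using components_nonoverlap bdry_components(1) * by blast
      then show "(case x of (g, L, ts) \<Rightarrow> g ` set ts) \<inter> (case y of (g, L, ts) \<Rightarrow> g ` set ts) = {}"
        by auto
    qed
  qed auto
  finally show ?thesis .
qed

text \<open>Two symbols per sample plus one marker per component; as every net is nonempty, the
  marker costs at most one further symbol per sample.\<close>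

lemma length_boundary_layer: "length (boundary_layer \<S> \<epsilon> d) \<le> 3 * card (boundary_samples d)"
proof -
  have "length (boundary_layer \<S> \<epsilon> d) =
      sum_list (map (\<lambda>(g, L, ts). 2 * length ts + 1) (bdry d))"
    unfolding boundary_layer_def length_concat map_map
    by (rule arg_cong [where f = sum_list], rule map_cong)
       (auto simp: length_concat o_def sum_list_triv)
  also have "\<dots> \<le> sum_list (map (\<lambda>x. 3 * (case x of (g, L, ts) \<Rightarrow> length ts)) (bdry d))"
    using bdry_net_nonempty by (intro sum_list_mono) (force simp: Suc_le_eq)
  also have "\<dots> = 3 * card (boundary_samples d)"
    by (simp add: sum_list_const_mult flip: sum_length_bdry_nets)
  finally show ?thesis .
qed

end

text \<open>The ratio \<eta> of sample separation to triangle diameter is fixed by the scheme, so a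
  single packing number \<open>m\<close> serves all resolutions.\<close>

lemma card_boundary_samples_le:
  assumes "valid_scheme \<S>"
  obtains m :: nat where
    "\<And>\<epsilon> \<tau> \<gamma> d. admissible \<S> \<epsilon> d \<Longrightarrow> compact (srf d) \<Longrightarrow> 0 < \<epsilon> \<Longrightarrow> \<epsilon> \<le> \<tau> \<Longrightarrow>
       surface_thickness_ge (collar_const \<S>) (graph_const \<S>) \<gamma> (srf d) \<tau> \<Longrightarrow>
       card (boundary_samples d) \<le> m * length (triangles d)"
proof -
  define \<eta> where "\<eta> = min (collar_const \<S>) (1 / (2 * graph_const \<S>))"
  have c0: "0 < collar_const \<S>" and L0: "1 \<le> graph_const \<S>"
    using assms by (auto simp: valid_scheme_def)
  then have "0 < \<eta>"
    by (simp add: \<eta>_def)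
  then obtain m where m: "\<And>(x::pt) \<epsilon> S. 0 < \<epsilon> \<Longrightarrow> S \<subseteq> cball x \<epsilon> \<Longrightarrow>
       (\<forall>p\<in>S. \<forall>q\<in>S. p \<noteq> q \<longrightarrow> \<eta> * \<epsilon> \<le> dist p q) \<Longrightarrow> card S \<le> m"
    using separated_subset_cball_card_le by blast
  have "card (boundary_samples d) \<le> m * length (triangles d)"
    if adm: "admissible \<S> \<epsilon> d" and cpt: "compact (srf d)" and \<epsilon>: "0 < \<epsilon>" "\<epsilon> \<le> \<tau>"
      and thick: "surface_thickness_ge (collar_const \<S>) (graph_const \<S>) \<gamma> (srf d) \<tau>"
    for \<epsilon> \<tau> \<gamma> d
  proof -
    let ?Q = "boundary_samples d"
    have per_triangle: "card (?Q \<inter> \<phi> ` std_triangle) \<le> m" if \<phi>: "\<phi> \<in> set (triangles d)" for \<phi>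
    proof (cases "?Q \<inter> \<phi> ` std_triangle = {}")
      case False
      then obtain x where x: "x \<in> \<phi> ` std_triangle"
        by blast
      have tri: "triangulation \<S> \<epsilon> (srf d) (triangles d)"
        using adm by (simp add: admissible_def)
      then have "(\<Union>\<phi>\<in>set (triangles d). \<phi> ` std_triangle) = srf d"
        unfolding triangulation_def by (rule conjunct1)
      then have "\<phi> ` std_triangle \<subseteq> srf d"
        using \<phi> by (metis UN_upper)
      moreover have diam: "diameter (\<phi> ` std_triangle) \<le> \<epsilon>"
        using tri \<phi> by (simp add: triangulation_def)
      \<comment> \<open>The diameter controls distances only in bounded sets; compactness of the
        surface provides boundedness.\<close>
      ultimately have "bounded (\<phi> ` std_triangle)"
        using bounded_subset compact_imp_bounded [OF cpt] by blast
      then have "\<phi> ` std_triangle \<subseteq> cball x \<epsilon>"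
        using diameter_bounded_bound [OF _ x] diam by force
      then show ?thesis
        using boundary_samples_separated [OF adm thick c0 L0 \<epsilon>]
        by (intro m [OF \<epsilon>(1), of _ x]) (auto simp: \<eta>_def)
    qed simp
    have "?Q = (\<Union>\<phi>\<in>set (triangles d). ?Q \<inter> \<phi> ` std_triangle)"
      using boundary_samples_subset [OF adm] by blast
    then have "card ?Q \<le> (\<Sum>\<phi>\<in>set (triangles d). card (?Q \<inter> \<phi> ` std_triangle))"
      using card_UN_le [of "set (triangles d)" "\<lambda>\<phi>. ?Q \<inter> \<phi> ` std_triangle"] by simp
    also have "\<dots> \<le> m * card (set (triangles d))"
      using sum_bounded_above [of "set (triangles d)" "\<lambda>\<phi>. card (?Q \<inter> \<phi> ` std_triangle)" m] per_triangle
      by (simp add: mult.commute)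
    also have "\<dots> \<le> m * length (triangles d)"
      by (simp add: card_length)
    finally show ?thesis .
  qed
  then show thesis
    using that by blast
qed

section \<open>Word length and alphabet\<close>

text \<open>The quadratic terms come from the adjacency table and from the relative positions of
  curve edges and triangles; the 4 counts the layer separators.\<close>

lemma length_raw_word_le:
  fixes d :: discretization
  defines "n \<equiv> length (crv_net d)" and "T \<equiv> length (triangles d)"
  assumes "admissible \<S> \<epsilon> d"
  shows "length (raw_word \<S> \<tau> \<epsilon> d) \<le>
    2 * n + 3 * T + T\<^sup>2 + n * T + 3 * card (boundary_samples d) + 4"
proof -
  have "length (curve_layer \<S> \<epsilon> d) = 2 * n"
    by (simp add: curve_layer_def length_concat o_def sum_list_triv n_def)
  moreover have "length (triangle_layer \<S> \<tau> \<epsilon> d) = 3 * T"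
    by (simp add: triangle_layer_def Let_def length_concat o_def sum_list_triv T_def)
  moreover have "length (adjacency_layer d) \<le> T\<^sup>2"
  proof -
    have "length (adjacency_layer d) = sum_list (map (\<lambda>i. i) [0..<T])"
      by (simp add: adjacency_layer_def length_concat o_def T_def)
    also have "\<dots> \<le> sum_list (map (\<lambda>i. T) [0..<T])"
      by (intro sum_list_mono) auto
    finally show ?thesis
      by (simp add: sum_list_triv power2_eq_square)
  qed
  moreover have "length (position_layer \<S> \<tau> \<epsilon> d) \<le> n * T"
  proof -
    have "length (position_layer \<S> \<tau> \<epsilon> d) =
        sum_list (map (\<lambda>i. length (filter (near \<epsilon> d i) [0..<T])) [0..<n])"
      by (simp add: position_layer_def length_concat o_def T_def n_def)
    also have "\<dots> \<le> sum_list (map (\<lambda>i. T) [0..<n])"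
      by (intro sum_list_mono order_trans [OF length_filter_le]) simp
    finally show ?thesis
      by (simp add: sum_list_triv)
  qed
  ultimately show ?thesis
    using length_boundary_layer [OF assms(3)] by (simp add: raw_word_def)
qed

text \<open>Splitting off the first letter multiplies the count by \<open>card A\<close> and adds 1
  for the empty word, which is absorbed by the extra 1 in the base.\<close>

lemma card_lists_length_le_power:
  assumes "finite A"
  shows "card {xs. set xs \<subseteq> A \<and> length xs \<le> n} \<le> (card A + 1) ^ n"
proof (induction n)
  case 0
  have "{xs. set xs \<subseteq> A \<and> length xs \<le> 0} = {[]}"
    by auto
  then show ?case
    by simp
next
  case (Suc n)
  let ?W = "\<lambda>n. {xs. set xs \<subseteq> A \<and> length xs \<le> n}"
  have fin: "finite (?W n)"
    by (rule finite_lists_length_le [OF assms])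
  have "?W (Suc n) \<subseteq> insert [] ((\<lambda>(x, xs). x # xs) ` (A \<times> ?W n))"
  proof
    fix xs assume "xs \<in> ?W (Suc n)"
    then show "xs \<in> insert [] ((\<lambda>(x, xs). x # xs) ` (A \<times> ?W n))"
      by (cases xs) auto
  qed
  then have "card (?W (Suc n)) \<le> card (insert [] ((\<lambda>(x, xs). x # xs) ` (A \<times> ?W n)))"
    using assms fin by (intro card_mono) auto
  also have "\<dots> \<le> Suc (card ((\<lambda>(x, xs). x # xs) ` (A \<times> ?W n)))"
    using assms fin by (simp add: card_insert_if)
  also have "\<dots> \<le> Suc (card (A \<times> ?W n))"
    using assms fin by (intro Suc_leI le_imp_less_Suc card_image_le) auto
  also have "\<dots> \<le> (card A + 1) * (card A + 1) ^ n"
  proof -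
    have "card A * card (?W n) \<le> card A * (card A + 1) ^ n"
      by (intro mult_left_mono Suc.IH) simp
    moreover have "1 \<le> (card A + 1) ^ n"
      by simp
    ultimately have "1 + card A * card (?W n) \<le> (card A + 1) ^ n + card A * (card A + 1) ^ n"
      by linarith
    then show ?thesis
      by (simp add: card_cartesian_product)
  qed
  finally show ?case
    by simp
qed

text \<open>Here \<open>s\<close> is half the side of the box in units of \<epsilon>. A cube meeting
  the box has its centre within \<open>s + 1/2\<close> units of the origin in each
  coordinate.\<close>

lemma card_cube_labels_le:
  fixes \<S> \<Lambda> \<Delta> \<tau> \<epsilon>
  defines "s \<equiv> box_side \<S> \<Lambda> \<Delta> \<tau> / (2 * \<epsilon>)"
  assumes "0 < \<epsilon>" "0 \<le> s"
  shows "finite (cube_labels \<S> \<Lambda> \<Delta> \<tau> \<epsilon>)"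
    and "real (card (cube_labels \<S> \<Lambda> \<Delta> \<tau> \<epsilon>)) \<le> (2 * s + 2) ^ 3"
proof -
  define R where "R = \<lfloor>s + 1/2\<rfloor>"
  \<comment> \<open>Labels are viewed as functions on the three coordinates, so that a finite
    product can be counted.\<close>
  have *: "vec_nth ` cube_labels \<S> \<Lambda> \<Delta> \<tau> \<epsilon> \<subseteq> (\<Pi>\<^sub>E i\<in>UNIV. {-R..R})"
  proof (intro image_subsetI PiE_I)
    fix k :: "int ^ 3" and i :: 3
    assume "k \<in> cube_labels \<S> \<Lambda> \<Delta> \<tau> \<epsilon>"
    then obtain x :: pt where x: "\<epsilon> * (of_int (k $ i) - 1/2) \<le> x $ i"
        "x $ i < \<epsilon> * (of_int (k $ i) + 1/2)" "\<bar>x $ i\<bar> \<le> s * \<epsilon>"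
      using \<open>0 < \<epsilon>\<close> by (auto simp: cube_labels_def lattice_cube_def s_def)
    then have "\<epsilon> * (of_int (k $ i) - 1/2) \<le> \<epsilon> * s" "\<epsilon> * (- s) \<le> \<epsilon> * (of_int (k $ i) + 1/2)"
      by (auto simp: mult.commute)
    then have "of_int (k $ i) - 1/2 \<le> s" "- s \<le> of_int (k $ i) + 1/2"
      using \<open>0 < \<epsilon>\<close> by (simp_all only: mult_le_cancel_left_pos)
    then have "- R \<le> k $ i \<and> k $ i \<le> R"
      unfolding R_def by linarith
    then show "k $ i \<in> {-R..R}"
      by simp
  qed simp
  have inj: "inj_on vec_nth (cube_labels \<S> \<Lambda> \<Delta> \<tau> \<epsilon>)"
    by (simp add: inj_on_def vec_eq_iff)
  have fin: "finite (\<Pi>\<^sub>E i\<in>(UNIV::3 set). {-R..R})"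
    by (intro finite_PiE) auto
  show "finite (cube_labels \<S> \<Lambda> \<Delta> \<tau> \<epsilon>)"
    using inj_on_finite [OF inj * fin] .
  have "0 \<le> R"
    using assms(3) by (simp add: R_def)
  have "card (cube_labels \<S> \<Lambda> \<Delta> \<tau> \<epsilon>) \<le> nat (2 * R + 1) ^ 3"
    using card_inj_on_le [OF inj * fin] \<open>0 \<le> R\<close> by (simp add: card_PiE add.commute power3_eq_cube)
  then have "real (card (cube_labels \<S> \<Lambda> \<Delta> \<tau> \<epsilon>)) \<le> real (nat (2 * R + 1) ^ 3)"
    by (simp only: of_nat_le_iff)
  also have "\<dots> = (2 * of_int R + 1) ^ 3"
    using \<open>0 \<le> R\<close> by simp
  also have "\<dots> \<le> (2 * s + 2) ^ 3"
  proof (rule power_mono)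
    show "2 * real_of_int R + 1 \<le> 2 * s + 2"
      unfolding R_def by linarith
  qed (use \<open>0 \<le> R\<close> in simp)
  finally show "real (card (cube_labels \<S> \<Lambda> \<Delta> \<tau> \<epsilon>)) \<le> (2 * s + 2) ^ 3" .
qed

text \<open>Only cubes and knot directions vary with budget and resolution; all other symbols form
  one finite set, of size \<open>E\<close>.\<close>

lemma card_alphabet_le:
  assumes "valid_scheme \<S>"
  obtains M E :: real where "0 \<le> M" "0 \<le> E"
    "\<And>\<Lambda> \<Delta> \<tau> \<epsilon>. 0 < \<epsilon> \<Longrightarrow> \<epsilon> \<le> 1 \<Longrightarrow> 0 \<le> box_side \<S> \<Lambda> \<Delta> \<tau> \<Longrightarrow>
       finite (alphabet \<S> \<Lambda> \<Delta> \<tau> \<epsilon>) \<and>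
       real (card (alphabet \<S> \<Lambda> \<Delta> \<tau> \<epsilon>)) \<le>
         (box_side \<S> \<Lambda> \<Delta> \<tau> / \<epsilon> + 2) ^ 3 + M / \<epsilon>\<^sup>2 + E"
proof -
  obtain M where "\<forall>\<epsilon>\<in>{0<..1}. real (card (knot_dirs \<S> \<epsilon>)) \<le> M / \<epsilon>\<^sup>2"
    using assms unfolding valid_scheme_def by (elim conjE exE)
  then have M: "real (card (knot_dirs \<S> \<epsilon>)) \<le> M / \<epsilon>\<^sup>2" if "0 < \<epsilon>" "\<epsilon> \<le> 1" for \<epsilon>
    using that by simp
  \<comment> \<open>Resolution 1 already forces this, since a cardinality is nonnegative.\<close>
  have "0 \<le> M"
    using order_trans [OF of_nat_0_le_iff M [of 1]] by simp
  define fixed where "fixed = Boundary_Direction ` boundary_dirs \<S> \<union> Normal_Line ` normal_lines \<S> \<union>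
     Sheet_Type ` sheet_symbols \<S> \<union> Incidence ` incidence_symbols \<S> \<union>
     range Adjacency \<union> {End_Boundary_Component, End_Layer}"
  have fixed: "finite fixed"
    using assms by (simp add: fixed_def valid_scheme_def)
  have "finite (alphabet \<S> \<Lambda> \<Delta> \<tau> \<epsilon>) \<and>
       real (card (alphabet \<S> \<Lambda> \<Delta> \<tau> \<epsilon>)) \<le>
         (box_side \<S> \<Lambda> \<Delta> \<tau> / \<epsilon> + 2) ^ 3 + M / \<epsilon>\<^sup>2 + real (card fixed)"
    if \<epsilon>: "0 < \<epsilon>" "\<epsilon> \<le> 1" and box: "0 \<le> box_side \<S> \<Lambda> \<Delta> \<tau>" for \<Lambda> \<Delta> \<tau> \<epsilon>
  proof -
    let ?Q = "cube_labels \<S> \<Lambda> \<Delta> \<tau> \<epsilon>" and ?D = "knot_dirs \<S> \<epsilon>"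
    have split: "alphabet \<S> \<Lambda> \<Delta> \<tau> \<epsilon> = Cube ` ?Q \<union> Knot_Direction ` ?D \<union> fixed"
      by (simp add: alphabet_def fixed_def Un_assoc)
    have s: "0 \<le> box_side \<S> \<Lambda> \<Delta> \<tau> / (2 * \<epsilon>)"
      using box \<epsilon> by simp
    have fin: "finite ?Q" "finite ?D"
      using card_cube_labels_le(1) [OF \<epsilon>(1) s] assms \<epsilon> by (auto simp: valid_scheme_def)
    have "card (alphabet \<S> \<Lambda> \<Delta> \<tau> \<epsilon>) \<le> card (Cube ` ?Q) + card (Knot_Direction ` ?D) + card fixed"
      unfolding split by (intro order_trans [OF card_Un_le] add_mono card_Un_le order_refl)
    also have "\<dots> \<le> card ?Q + card ?D + card fixed"
      using fin by (intro add_mono card_image_le order_refl)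
    finally have "real (card (alphabet \<S> \<Lambda> \<Delta> \<tau> \<epsilon>)) \<le>
        real (card ?Q) + real (card ?D) + real (card fixed)"
      by linarith
    moreover have "real (card ?Q) \<le> (box_side \<S> \<Lambda> \<Delta> \<tau> / \<epsilon> + 2) ^ 3"
      using card_cube_labels_le(2) [OF \<epsilon>(1) s] \<epsilon> by simp
    ultimately show ?thesis
      using M [OF \<epsilon>] fin fixed by (simp add: split)
  qed
  then show thesis
    using that [of M "real (card fixed)"] \<open>0 \<le> M\<close> by simp
qed

section \<open>Counting encoded types\<close>

text \<open>An encoded type is in particular a raw word of its class, and the members of a class are
  essential pairs.\<close>

lemma encoded_type_discretization:
  assumes "w \<in> encoded_types \<S> K \<Lambda> \<Delta> \<tau> \<epsilon>"
  obtains d where "w = raw_word \<S> \<tau> \<epsilon> d" "admissible \<S> \<epsilon> d"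
    "set w \<subseteq> alphabet \<S> \<Lambda> \<Delta> \<tau> \<epsilon>" "(crv d, srf d) \<in> essential_pairs \<S> K \<Lambda> \<Delta> \<tau>"
proof -
  obtain P where P: "P \<in> Z_ess \<S> K \<Lambda> \<Delta> \<tau>" "w \<in> raw_words \<S> \<Lambda> \<Delta> \<tau> \<epsilon> P"
    using assms by (auto simp: encoded_types_def is_encoded_type_def)
  have "P \<subseteq> essential_pairs \<S> K \<Lambda> \<Delta> \<tau>"
    using P(1) by (auto simp: Z_ess_def Let_def elim!: quotientE)
  then show thesis
    using P(2) that by (auto simp: raw_words_def)
qed

lemma admissible_cell_counts:
  assumes "admissible \<S> \<epsilon> d" "(crv d, srf d) \<in> essential_pairs \<S> K \<Lambda> \<Delta> \<tau>"
    and "0 < curve_cell_const \<S>" "0 < surface_cell_const \<S>" "0 < \<epsilon>" "0 \<le> \<Delta>"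
  shows "real (length (crv_net d)) \<le> curve_cell_const \<S> * (\<Lambda> / \<epsilon>)"
    and "real (length (triangles d)) \<le> surface_cell_const \<S> * (\<Delta> / \<epsilon>\<^sup>2)"
proof -
  have len: "curve_length (crv d) \<le> \<Lambda>" and area: "area (srf d) \<le> ennreal \<Delta>"
    using assms(2) by (auto simp: essential_pairs_def)
  have "real (length (crv_net d)) \<le> curve_cell_const \<S> * (curve_length (crv d) / \<epsilon>)"
    using assms(1) by (simp add: admissible_def)
  also have "\<dots> \<le> curve_cell_const \<S> * (\<Lambda> / \<epsilon>)"
    using len assms by (intro mult_left_mono divide_right_mono) auto
  finally show "real (length (crv_net d)) \<le> curve_cell_const \<S> * (\<Lambda> / \<epsilon>)" .
  \<comment> \<open>The area is an extended real, so the chain is carried out there and transferred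
    back at its nonnegative finite end.\<close>
  have "ennreal (real (length (triangles d))) \<le> ennreal (surface_cell_const \<S> / \<epsilon>\<^sup>2) * area (srf d)"
    using assms(1) by (simp add: admissible_def)
  also have "\<dots> \<le> ennreal (surface_cell_const \<S> / \<epsilon>\<^sup>2) * ennreal \<Delta>"
    using area by (intro mult_left_mono) auto
  also have "\<dots> = ennreal (surface_cell_const \<S> * (\<Delta> / \<epsilon>\<^sup>2))"
    using assms by (simp flip: ennreal_mult)
  finally show "real (length (triangles d)) \<le> surface_cell_const \<S> * (\<Delta> / \<epsilon>\<^sup>2)"
    using assms by (subst (asm) ennreal_le_iff) auto
qed

theorem corollary4p14:
  fixes \<S> :: encoding_scheme
  assumes "valid_scheme \<S>"
  shows "\<exists>B>0. \<exists>C>0. \<forall>K \<Lambda> \<Delta> \<tau> \<epsilon>.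
    knot_type K \<and> 0 < \<Lambda> \<and> 0 < \<Delta> \<and> 0 < \<tau> \<and> 0 < \<epsilon> \<and> \<epsilon> \<le> resolution_const \<S> * min 1 \<tau> \<longrightarrow>
    (let N = real_of_int \<lceil>C * (\<Lambda> / \<epsilon> + \<Delta> / \<epsilon>\<^sup>2)\<rceil> in
       finite (encoded_types \<S> K \<Lambda> \<Delta> \<tau> \<epsilon>) \<and>
       real (card (encoded_types \<S> K \<Lambda> \<Delta> \<tau> \<epsilon>)) \<le> (C * N) powr (B * N\<^sup>2))"
proof -
  define kc ks cd where "kc = curve_cell_const \<S>" and "ks = surface_cell_const \<S>"
    and "cd = diam_const \<S>"
  have pos: "0 < kc" "0 < ks" "0 < cd" "0 < resolution_const \<S>" "resolution_const \<S> \<le> 1"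
    using assms by (simp_all add: valid_scheme_def kc_def ks_def cd_def)
  obtain m where m: "\<And>\<epsilon> \<tau> \<gamma> d. admissible \<S> \<epsilon> d \<Longrightarrow> compact (srf d) \<Longrightarrow> 0 < \<epsilon> \<Longrightarrow> \<epsilon> \<le> \<tau> \<Longrightarrow>
       surface_thickness_ge (collar_const \<S>) (graph_const \<S>) \<gamma> (srf d) \<tau> \<Longrightarrow>
       card (boundary_samples d) \<le> m * length (triangles d)"
    using card_boundary_samples_le [OF assms] by blast
  obtain M E where ME: "0 \<le> M" "0 \<le> E" and alph:
    "\<And>\<Lambda> \<Delta> \<tau> \<epsilon>. 0 < \<epsilon> \<Longrightarrow> \<epsilon> \<le> 1 \<Longrightarrow> 0 \<le> box_side \<S> \<Lambda> \<Delta> \<tau> \<Longrightarrow>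
       finite (alphabet \<S> \<Lambda> \<Delta> \<tau> \<epsilon>) \<and>
       real (card (alphabet \<S> \<Lambda> \<Delta> \<tau> \<epsilon>)) \<le>
         (box_side \<S> \<Lambda> \<Delta> \<tau> / \<epsilon> + 2) ^ 3 + M / \<epsilon>\<^sup>2 + E"
    using card_alphabet_le [OF assms] by blast
  \<comment> \<open>Coefficient of \<open>N\<^sup>2\<close> in the word length, obtained from at
    most \<open>kc * N\<close> curve cells, \<open>ks * N\<close> triangles and \<open>m\<close>
    samples per triangle.\<close>
  define kW where "kW = 2 * kc + 3 * ks + ks\<^sup>2 + kc * ks + 3 * (m * ks) + 4"
  \<comment> \<open>Coefficient of \<open>N ^ 3\<close> in the alphabet size plus one: cubes, knot
    directions, fixed symbols, and the extra 1 of the word count.\<close>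
  define C where "C = (2 * cd + 7) ^ 3 + 4 * M + E + 1"
  have C: "1 \<le> C"
    using pos ME by (simp add: C_def)
  have kW: "0 < kW"
    using pos by (simp add: kW_def add_nonneg_pos)
  \<comment> \<open>The factor 3 in the exponent is the power of \<open>C * N\<close> that bounds
    the alphabet.\<close>
  have "finite (encoded_types \<S> K \<Lambda> \<Delta> \<tau> \<epsilon>) \<and>
      real (card (encoded_types \<S> K \<Lambda> \<Delta> \<tau> \<epsilon>)) \<le> (C * N) powr (3 * kW * N\<^sup>2)"
    if K: "knot_type K" and par: "0 < \<Lambda>" "0 < \<Delta>" "0 < \<tau>" "0 < \<epsilon>"
      and res: "\<epsilon> \<le> resolution_const \<S> * min 1 \<tau>"
      and N: "N = real_of_int \<lceil>C * (\<Lambda> / \<epsilon> + \<Delta> / \<epsilon>\<^sup>2)\<rceil>" for K \<Lambda> \<Delta> \<tau> \<epsilon> N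
  \<comment> \<open>A nonempty set of types provides a curve of reach one, hence a lower bound on
    \<Lambda>.\<close>
  proof (cases "encoded_types \<S> K \<Lambda> \<Delta> \<tau> \<epsilon> = {}")
    case False
    have "resolution_const \<S> * min 1 \<tau> \<le> 1 * min 1 \<tau>"
      using pos par by (intro mult_right_mono) auto
    with res have \<epsilon>: "\<epsilon> \<le> 1" "\<epsilon> \<le> \<tau>"
      by auto
    define x where "x = \<Lambda> / \<epsilon> + \<Delta> / \<epsilon>\<^sup>2"
    have x: "0 < x" "\<Lambda> / \<epsilon> \<le> x" "\<Delta> / \<epsilon>\<^sup>2 \<le> x"
      using par by (auto simp: x_def add_pos_pos)
    \<comment> \<open>The same \<open>C\<close> stands inside the ceiling and in the base;
      \<open>C \<ge> 1\<close> keeps \<open>N\<close> above the budget \<open>x\<close>.\<close>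
    have "x \<le> C * x"
      using C x(1) by simp
    also have "C * x \<le> N"
      by (simp add: N x_def)
    finally have "x \<le> N" .
    \<comment> \<open>A positive ceiling is at least 1, so lower powers of \<open>N\<close> can be
      raised to higher ones.\<close>
    have "0 < C * x"
      using C x(1) by simp
    then have "0 < \<lceil>C * x\<rceil>"
      by simp
    then have "1 \<le> N"
      unfolding N x_def [symmetric] by linarith
    have \<Lambda>: "1 / 2 \<le> \<Lambda>"
    proof -
      obtain w where "w \<in> encoded_types \<S> K \<Lambda> \<Delta> \<tau> \<epsilon>"
        using False by blast
      then obtain d where "w = raw_word \<S> \<tau> \<epsilon> d" "admissible \<S> \<epsilon> d"
          "set w \<subseteq> alphabet \<S> \<Lambda> \<Delta> \<tau> \<epsilon>"
        and pair: "(crv d, srf d) \<in> essential_pairs \<S> K \<Lambda> \<Delta> \<tau>"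
        by (rule encoded_type_discretization)
      from pair have "crv d \<in> K" and "reach (crv d) = 1" and "curve_length (crv d) \<le> \<Lambda>"
        by (simp_all add: essential_pairs_def)
      moreover from \<open>crv d \<in> K\<close> K have "closed_curve (crv d)"
        unfolding knot_type_def by blast
      ultimately show ?thesis
        using curve_length_ge order_trans by blast
    qed
    have inv: "1 / \<epsilon> \<le> 2 * N"
    proof -
      have "1 / \<epsilon> \<le> 2 * \<Lambda> / \<epsilon>"
        using \<Lambda> par by (intro divide_right_mono) auto
      then show ?thesis
        using x \<open>x \<le> N\<close> by simp
    qed
    have box0: "0 \<le> box_side \<S> \<Lambda> \<Delta> \<tau>"
      using par pos by (simp add: box_side_def flip: cd_def)
    \<comment> \<open>The diameter term of the box is turned into the area budget by \<epsilon>
      \<le> \<tau>.\<close>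
    have "\<Delta> / (\<tau> * \<epsilon>) \<le> \<Delta> / \<epsilon>\<^sup>2"
      using par \<epsilon> by (intro divide_left_mono) (auto simp: power2_eq_square)
    then have "2 * cd * (\<Delta> / (\<tau> * \<epsilon>)) \<le> 2 * cd * N"
      using pos x \<open>x \<le> N\<close> by (intro mult_left_mono) auto
    moreover have "box_side \<S> \<Lambda> \<Delta> \<tau> / \<epsilon> = \<Lambda> / \<epsilon> + 2 * (1 / \<epsilon>) + 2 * cd * (\<Delta> / (\<tau> * \<epsilon>))"
      using par by (simp add: box_side_def cd_def field_simps)
    \<comment> \<open>The 7 is 1 from the curve length, 4 from the additive constant of the box via
      \<open>1 / \<epsilon> \<le> 2 * N\<close>, and 2 from the rounding to cubes.\<close>
    ultimately have "box_side \<S> \<Lambda> \<Delta> \<tau> / \<epsilon> + 2 \<le> N + 2 * (2 * N) + 2 * cd * N + 2 * N"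
      using inv x \<open>x \<le> N\<close> \<open>1 \<le> N\<close> by linarith
    also have "\<dots> = (2 * cd + 7) * N"
      by (simp add: algebra_simps)
    finally have cubes: "(box_side \<S> \<Lambda> \<Delta> \<tau> / \<epsilon> + 2) ^ 3 \<le> ((2 * cd + 7) * N) ^ 3"
      using box0 par by (intro power_mono) auto
    have N23: "N\<^sup>2 \<le> N ^ 3" "1 \<le> N ^ 3" "N \<le> N\<^sup>2" "1 \<le> N\<^sup>2"
      using \<open>1 \<le> N\<close> by (auto intro: power_increasing self_le_power)
    have dirs: "M / \<epsilon>\<^sup>2 \<le> 4 * M * N ^ 3"
    proof -
      have "(1 / \<epsilon>)\<^sup>2 \<le> (2 * N)\<^sup>2"
        using inv par by (intro power_mono) auto
      then have "(1 / \<epsilon>)\<^sup>2 \<le> 4 * N ^ 3"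
        using N23(1) by (simp add: power_mult_distrib)
      from mult_left_mono [OF this ME(1)] show ?thesis
        by (simp add: power_divide mult_ac)
    qed
    let ?A = "alphabet \<S> \<Lambda> \<Delta> \<tau> \<epsilon>"
    have finA: "finite ?A" and "real (card ?A) \<le>
         (box_side \<S> \<Lambda> \<Delta> \<tau> / \<epsilon> + 2) ^ 3 + M / \<epsilon>\<^sup>2 + E"
      using alph [OF par(4) \<epsilon>(1) box0] by auto
    then have "real (card ?A + 1) \<le> ((2 * cd + 7) * N) ^ 3 + 4 * M * N ^ 3 + (E + 1) * 1"
      using cubes dirs by simp
    also have "\<dots> \<le> ((2 * cd + 7) * N) ^ 3 + 4 * M * N ^ 3 + (E + 1) * N ^ 3"
      using N23 ME by (intro add_left_mono mult_left_mono) auto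
    also have "\<dots> = C * N ^ 3"
      unfolding C_def power_mult_distrib by (simp add: distrib_right)
    \<comment> \<open>Enlarging \<open>C\<close> to its cube makes the bound a pure power of
      \<open>C * N\<close>.\<close>
    also have "\<dots> \<le> C ^ 3 * N ^ 3"
      using C \<open>1 \<le> N\<close> by (intro mult_right_mono self_le_power) auto
    finally have cardA: "real (card ?A + 1) \<le> (C * N) ^ 3"
      by (simp add: power_mult_distrib)
    \<comment> \<open>Rounding down loses nothing, since word lengths are natural numbers.\<close>
    define W where "W = nat \<lfloor>kW * N\<^sup>2\<rfloor>"
    have "length w \<le> W \<and> set w \<subseteq> ?A" if w: "w \<in> encoded_types \<S> K \<Lambda> \<Delta> \<tau> \<epsilon>" for w
    proof -
      obtain d where d: "w = raw_word \<S> \<tau> \<epsilon> d" "admissible \<S> \<epsilon> d" "set w \<subseteq> ?A"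
        "(crv d, srf d) \<in> essential_pairs \<S> K \<Lambda> \<Delta> \<tau>"
        by (rule encoded_type_discretization [OF w])
      let ?n = "length (crv_net d)" and ?T = "length (triangles d)"
      have "real ?n \<le> kc * (\<Lambda> / \<epsilon>)" "real ?T \<le> ks * (\<Delta> / \<epsilon>\<^sup>2)"
        using admissible_cell_counts [OF d(2,4)] pos par by (auto simp: kc_def ks_def)
      moreover have "kc * (\<Lambda> / \<epsilon>) \<le> kc * N"
        using x \<open>x \<le> N\<close> pos by (intro mult_left_mono) auto
      moreover have "ks * (\<Delta> / \<epsilon>\<^sup>2) \<le> ks * N"
        using x \<open>x \<le> N\<close> pos by (intro mult_left_mono) auto
      ultimately have nT: "real ?n \<le> kc * N" "real ?T \<le> ks * N"
        by linarith+
      have "kc * N \<le> kc * N\<^sup>2" "ks * N \<le> ks * N\<^sup>2"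
        using N23 pos by auto
      with nT have nT2: "real ?n \<le> kc * N\<^sup>2" "real ?T \<le> ks * N\<^sup>2"
        by linarith+
      have "card (boundary_samples d) \<le> m * ?T"
        using d(4)
        by (intro m [OF d(2) _ par(4) \<epsilon>(2), of "crv d"])
           (simp_all add: essential_pairs_def proper_surface_def)
      then have "length w \<le> 2 * ?n + 3 * ?T + ?T\<^sup>2 + ?n * ?T + 3 * (m * ?T) + 4"
        using length_raw_word_le [OF d(2), of \<tau>] unfolding d(1) by linarith
      then have "real (length w) \<le> real (2 * ?n + 3 * ?T + ?T\<^sup>2 + ?n * ?T + 3 * (m * ?T) + 4)"
        by (simp only: of_nat_le_iff)
      also have "\<dots> = 2 * real ?n + 3 * real ?T + (real ?T)\<^sup>2 + real ?n * real ?T + 3 * (m * real ?T) + 4"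
        by simp
      \<comment> \<open>Linear and constant terms are raised to \<open>N\<^sup>2\<close>; the
        products are quadratic already.\<close>
      also have "\<dots> \<le> 2 * (kc * N\<^sup>2) + 3 * (ks * N\<^sup>2) + (ks * N)\<^sup>2 + (kc * N) * (ks * N)
          + 3 * (m * (ks * N\<^sup>2)) + 4 * N\<^sup>2"
        using nT nT2 N23 pos \<open>1 \<le> N\<close>
        by (intro add_mono mult_left_mono mult_mono power_mono) auto
      also have "\<dots> = kW * N\<^sup>2"
        by (simp add: kW_def power2_eq_square algebra_simps)
      finally show ?thesis
        using d(3) unfolding W_def by (simp add: le_nat_floor)
    qed
    then have sub: "encoded_types \<S> K \<Lambda> \<Delta> \<tau> \<epsilon> \<subseteq> {w. set w \<subseteq> ?A \<and> length w \<le> W}"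
      by blast
    have fin: "finite {w. set w \<subseteq> ?A \<and> length w \<le> W}"
      by (rule finite_lists_length_le [OF finA])
    have "card (encoded_types \<S> K \<Lambda> \<Delta> \<tau> \<epsilon>) \<le> (card ?A + 1) ^ W"
      using card_mono [OF fin sub] card_lists_length_le_power [OF finA, of W] by linarith
    then have "real (card (encoded_types \<S> K \<Lambda> \<Delta> \<tau> \<epsilon>)) \<le> real (card ?A + 1) ^ W"
      by (metis of_nat_le_iff of_nat_power)
    also have "\<dots> \<le> ((C * N) ^ 3) ^ W"
      using cardA by (intro power_mono) auto
    also have "\<dots> = (C * N) powr real (3 * W)"
      using C \<open>1 \<le> N\<close> by (subst powr_realpow) (simp_all add: power_mult)
    \<comment> \<open>Enlarging the real exponent is allowed because the base is at least 1.\<close>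
    also have "\<dots> \<le> (C * N) powr (3 * kW * N\<^sup>2)"
    proof (rule powr_mono)
      show "1 \<le> C * N"
        using mult_mono [OF C \<open>1 \<le> N\<close>] C by simp
      have "real W \<le> kW * N\<^sup>2"
        using kW unfolding W_def by (simp add: of_nat_floor)
      then show "real (3 * W) \<le> 3 * kW * N\<^sup>2"
        by simp
    qed
    finally show ?thesis
      using finite_subset [OF sub fin] by blast
  qed simp
  then show ?thesis
    using kW C by (intro exI [of _ "3 * kW"] exI [of _ C] conjI) (auto simp: Let_def)
qed

end
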